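(* Let $(M,0)$ be a real $\mathcal{C}^\infty$-smooth hypersurface germ at $0\in\mathbb C^2$ defined by the equation $$\rho(z_1,z_2)=\mathrm{Re}\,z_1+P(z_2)+ (\mathrm{Im}\,z_1)\, Q(z_2,\mathrm{Im}\,z_1)=0,$$ where $P$ and $Q$ are real-valued functions on $\{|z_2|<\epsilon_0\}$ and $\{|z_2|<\epsilon_0\}\times(-\delta_0,\delta_0)$ respectively ($\epsilon_0,\delta_0>0$), satisfying the conditions: (i) $P,Q$ are $\mathcal{C}^\infty$-smooth with $P(0)=Q(0,0)=0$; (ii) $P(z_2)=P(|z_2|)$ and $Q(z_2,t)=Q(|z_2|,t)$ for any $z_2$ and $t$; (iii) $P(z_2)>0$ for any $z_2 \neq 0$; (iv) $P(z_2)$ vanishes to infinite order at $z_2=0$. For $t\in\mathbb R$ let $R_t(z_1,z_2)=(z_1,z_2e^{it})$. Then $\mathrm{Aut}(M,0)=\{R_t : t\in \mathbb R\}$.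
   Context: For a real hypersurface germ $M$ at $0\in\mathbb C^2$, $\mathrm{Aut}(M,0)$ (the stability group) is the group of germs at $0$ of biholomorphisms of $\mathbb C^2$ fixing $0$ and mapping $M$ into itself. A $\mathcal C^\infty$-smooth function vanishes to infinite order at a point if all its partial derivatives of all orders (including order $0$) vanish there. *)

theory Defs
  imports "HOL-Analysis.Analysis"
begin

fun iter_partial :: "'a::euclidean_space list \<Rightarrow> ('a \<Rightarrow> real) \<Rightarrow> 'a \<Rightarrow> real" where
  "iter_partial [] f = f"
| "iter_partial (v # vs) f = (\<lambda>x. frechet_derivative (iter_partial vs f) (at x) v)"

text \<open>Used for open \<open>S\<close> only. Every iterated partial derivative being differentiable is
  equivalent to all of them existing and being continuous. The coordinate directions of
  \<open>complex\<close> are \<open>1\<close> and \<open>\<i>\<close>, so the partial derivatives there are the real ones.\<close>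

definition smooth_on :: "'a::euclidean_space set \<Rightarrow> ('a \<Rightarrow> real) \<Rightarrow> bool" where
  "smooth_on S f \<longleftrightarrow>
     (\<forall>vs. set vs \<subseteq> Basis \<longrightarrow> (\<forall>x\<in>S. iter_partial vs f differentiable (at x)))"

definition vanishes_to_infinite_order :: "('a::euclidean_space \<Rightarrow> real) \<Rightarrow> 'a \<Rightarrow> bool" where
  "vanishes_to_infinite_order f a \<longleftrightarrow>
     (\<forall>vs. set vs \<subseteq> Basis \<longrightarrow> iter_partial vs f a = 0)"

text \<open>Complex differentiability in two variables: the real derivative is given by a complex
  \<open>2 \<times> 2\<close> Jacobian matrix, i.e. it is complex linear.\<close>

definition holomorphic2_on :: "(complex \<times> complex \<Rightarrow> complex \<times> complex) \<Rightarrow> (complex \<times> complex) set \<Rightarrow> bool" where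
  "holomorphic2_on f U \<longleftrightarrow>
     (\<forall>z\<in>U. \<exists>a b c d.
        (f has_derivative (\<lambda>(h1, h2). (a * h1 + b * h2, c * h1 + d * h2))) (at z))"

definition biholomorphic2 ::
  "(complex \<times> complex \<Rightarrow> complex \<times> complex) \<Rightarrow> (complex \<times> complex) set \<Rightarrow> (complex \<times> complex) set \<Rightarrow> bool" where
  "biholomorphic2 f U V \<longleftrightarrow>
     open U \<and> open V \<and> bij_betw f U V \<and>
     holomorphic2_on f U \<and> holomorphic2_on (inv_into U f) V"

definition germ_at :: "'a::topological_space \<Rightarrow> ('a \<Rightarrow> 'b) \<Rightarrow> ('a \<Rightarrow> 'b) set" where
  "germ_at a f = {g. \<forall>\<^sub>F x in nhds a. g x = f x}"

text \<open>\<open>Aut(M, 0)\<close>, depending only on the germ of \<open>M\<close> at \<open>0\<close>. The conditions on the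
  representative \<open>f\<close> depend only on its germ at \<open>0\<close>; outside a neighbourhood of \<open>0\<close> the
  representative is arbitrary.\<close>

definition stability_group ::
  "(complex \<times> complex) set \<Rightarrow> (complex \<times> complex \<Rightarrow> complex \<times> complex) set set" where
  "stability_group M =
     {germ_at 0 f | f.
        (\<exists>U V. 0 \<in> U \<and> biholomorphic2 f U V) \<and> f 0 = 0 \<and>
        (\<forall>\<^sub>F z in nhds 0. z \<in> M \<longrightarrow> f z \<in> M)}"

definition rotation :: "real \<Rightarrow> complex \<times> complex \<Rightarrow> complex \<times> complex" where
  "rotation t = (\<lambda>(z1, z2). (z1, z2 * exp (\<i> * of_real t)))"

end

theory Submission
  imports Defs "HOL-Complex_Analysis.Complex_Analysis"
begin

text \<open>Let \<open>f = (f1, f2)\<close> be a germ that fixes the origin and maps \<open>M\<close> into itself. It is tested at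
special points of \<open>M\<close>: whenever \<open>Re \<zeta> = -1\<close> and \<open>z\<close> is small, \<open>M\<close> contains a point \<open>(Z, z)\<close>
with \<open>Z = \<zeta> P(z) (1 + O(z))\<close>. As \<open>P\<close> is flat, every positive power of \<open>P(z)\<close> is negligible
against every power of \<open>z\<close>. Expand \<open>f1\<close> and \<open>f2\<close> in powers of \<open>z1\<close> with coefficients that are
holomorphic in \<open>z2\<close>; at the test points the first coefficient that does not vanish, and in it the
lowest power of \<open>z\<close>, dominates everything else. Subtracting the equation of \<open>M\<close> at \<open>(Z, z)\<close> from
the equation at \<open>f(Z, z)\<close> expresses \<open>P(f2(Z, z)) - P(z)\<close> through the real part of the leading term
of \<open>f1 - z1\<close>, up to a negligible error (\<open>defect_estimate\<close>).

The obstruction to a nontrivial \<open>f\<close> is one-dimensional. If for every small \<open>s\<close> there were some positive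
\<open>s' < s\<close> with \<open>P(s') \<ge> P(s) (s'/s)^N\<close>, then the least maximiser of \<open>P(s) / s^N\<close> on a short interval
would be beaten by a smaller one, although this quotient tends to \<open>0\<close> at the origin. The same argument,
read backwards, excludes steps from \<open>s\<close> to \<open>s' > s\<close>, at most proportional to \<open>s\<close>, with
\<open>P(s') \<le> P(s) (s'/s)^N\<close>. Hence moving \<open>|z|\<close> by a small
relative amount cannot always change \<open>P\<close> by a comparable relative amount only
(\<open>no_descent\<close>, \<open>no_ascent\<close>, \<open>no_radial_drift\<close>).

The curve \<open>z1 = 0\<close> touches \<open>M\<close> to infinite order, hence so does its image, and therefore
\<open>f1(0, z2) = 0\<close> (\<open>g1_vanishes_on_axis\<close>). To first order \<open>f\<close> multiplies \<open>|z|\<close> by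
\<open>|b|\<close>, \<open>b\<close> being the derivative of \<open>f2\<close> in \<open>z2\<close>, and \<open>P\<close> by a fixed positive factor;
the obstruction leaves only \<open>|b| = 1\<close> (\<open>cmod_multiplier_eq_1\<close>). After a rotation \<open>b = 1\<close>.
If \<open>f\<close> is then not the identity, let \<open>n\<close> be the least number such that
\<open>f1 = z1 + z1^(n+1) A(z2) + ...\<close>, \<open>f2 = z2 + z1^n B(z2) + ...\<close> with \<open>A\<close> and \<open>B\<close> not both zero, and let
\<open>\<alpha> z^m\<close>, \<open>\<beta> z^l\<close> be their leading terms. There are three cases.

\<^item> \<open>B\<close> is nonzero and \<open>l \<le> m + 1\<close> (or \<open>A = 0\<close>): in a suitable direction \<open>|z|\<close> drifts to one side by a
  relative amount that dominates the relative change of \<open>P\<close>, which contradicts the obstruction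
  (\<open>second_component_not_dominant\<close>).
\<^item> \<open>B = 0\<close>: then \<open>|z|\<close>, and with it \<open>P\<close>, is moved so little that the term \<open>A\<close> cannot be balanced
  (\<open>second_component_not_negligible\<close>).
\<^item> \<open>A\<close> and \<open>B\<close> are nonzero and \<open>m + 1 < l\<close>: every small circle contains a point, near a fixed direction,
  whose modulus \<open>f2\<close> preserves exactly; there \<open>P\<close> does not change at all, but the real part of the
  leading term of \<open>f1 - z1\<close> does not vanish (\<open>first_component_not_dominant\<close>).

So \<open>f\<close> is the identity after the rotation, and conversely rotations preserve \<open>M\<close> by radial symmetry.\<close>

section \<open>Smooth functions that vanish to infinite order\<close>

lemma iter_partial_append: "iter_partial (vs @ ws) f = iter_partial vs (iter_partial ws f)"
  by (induction vs) auto

lemma smooth_on_iter_partial: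
  assumes "smooth_on S f" "set ws \<subseteq> Basis"
  shows "smooth_on S (iter_partial ws f)"
  using assms unfolding smooth_on_def by (metis iter_partial_append le_sup_iff set_append)

lemma smooth_on_imp_differentiable: "smooth_on S f \<Longrightarrow> x \<in> S \<Longrightarrow> f differentiable (at x)"
  unfolding smooth_on_def by (metis bot.extremum iter_partial.simps(1) list.set(1))

lemma smooth_on_imp_isCont: "smooth_on S f \<Longrightarrow> x \<in> S \<Longrightarrow> isCont f x"
  using smooth_on_imp_differentiable differentiable_imp_continuous_within by blast

lemma smooth_on_lipschitz:
  fixes f :: "'a::euclidean_space \<Rightarrow> real"
  assumes "smooth_on S f" "convex B" "B \<subseteq> S"
    and "\<And>x b. x \<in> B \<Longrightarrow> b \<in> Basis \<Longrightarrow> \<bar>iter_partial [b] f x\<bar> \<le> K"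
    and "x \<in> B" "y \<in> B"
  shows "\<bar>f x - f y\<bar> \<le> real DIM('a) * K * norm (x - y)"
proof -
  have "norm (f x - f y) \<le> real DIM('a) * K * norm (x - y)"
  proof (rule differentiable_bound[OF \<open>convex B\<close> _ _ \<open>x \<in> B\<close> \<open>y \<in> B\<close>])
    fix u assume u: "u \<in> B"
    let ?D = "frechet_derivative f (at u)"
    have D: "(f has_derivative ?D) (at u)"
      using u assms smooth_on_imp_differentiable frechet_derivative_works by blast
    then show "(f has_derivative ?D) (at u within B)"
      by (rule has_derivative_at_withinI)
    have "onorm ?D \<le> (\<Sum>b\<in>Basis. norm (?D b))"
      using D by (intro onorm_componentwise has_derivative_bounded_linear)
    also have "\<dots> \<le> (\<Sum>b\<in>(Basis::'a set). K)"
      using assms(4)[OF u] by (intro sum_mono) auto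
    finally show "onorm ?D \<le> real DIM('a) * K" by simp
  qed
  then show ?thesis by simp
qed

text \<open>The mean value inequality on the discs \<open>cball a d\<close> turns growth bounds for the partial derivatives
into Lipschitz constants of the same order in \<open>d\<close>.\<close>

lemma smooth_on_lipschitz_of_partial_bounds:
  fixes f :: "'a::euclidean_space \<Rightarrow> real"
  assumes "smooth_on S f"
    and "\<And>b. b \<in> Basis \<Longrightarrow> \<exists>C r. r > 0 \<and> C \<ge> 0 \<and> ball a r \<subseteq> S \<and>
           (\<forall>x\<in>ball a r. \<bar>iter_partial [b] f x\<bar> \<le> C * dist a x ^ N)"
  shows "\<exists>C r. r > 0 \<and> C \<ge> 0 \<and> ball a r \<subseteq> S \<and> (\<forall>d x y. d < r \<longrightarrow> x \<in> cball a d \<longrightarrow> y \<in> cball a d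
           \<longrightarrow> \<bar>f x - f y\<bar> \<le> C * d ^ N * norm (x - y))"
proof -
  obtain C r where Cr: "\<And>b. b \<in> Basis \<Longrightarrow> r b > 0 \<and> C b \<ge> 0 \<and> ball a (r b) \<subseteq> S \<and>
      (\<forall>x\<in>ball a (r b). \<bar>iter_partial [b] f x\<bar> \<le> C b * dist a x ^ N)" using assms(2) by metis
  define r0 where "r0 = Min (r ` Basis)"
  define C0 where "C0 = sum C Basis"
  have r0: "r0 > 0" "\<And>b. b \<in> Basis \<Longrightarrow> r0 \<le> r b"
    unfolding r0_def using Cr by auto
  have C0: "C0 \<ge> 0" "\<And>b. b \<in> Basis \<Longrightarrow> C b \<le> C0"
    unfolding C0_def using Cr by (auto intro: sum_nonneg member_le_sum)
  have sub: "ball a r0 \<subseteq> S"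
    using r0(2) Cr by (meson SOME_Basis dual_order.trans subset_ball)
  have "\<bar>f x - f y\<bar> \<le> real DIM('a) * C0 * d ^ N * norm (x - y)"
    if d: "d < r0" and xy: "x \<in> cball a d" "y \<in> cball a d" for d x y
  proof -
    have "\<bar>f x - f y\<bar> \<le> real DIM('a) * (C0 * d ^ N) * norm (x - y)"
    proof (rule smooth_on_lipschitz[OF assms(1), of "cball a d"])
      show "cball a d \<subseteq> S" using d sub by (auto simp: subset_iff)
      fix u b assume u: "u \<in> cball a d" and b: "b \<in> (Basis::'a set)"
      then have "u \<in> ball a (r b)" using d r0(2)[OF b] by auto
      then have "\<bar>iter_partial [b] f u\<bar> \<le> C b * dist a u ^ N" using Cr[OF b] by blast
      also have "\<dots> \<le> C0 * d ^ N"
        using C0 b u Cr[OF b] by (intro mult_mono power_mono) auto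
      finally show "\<bar>iter_partial [b] f u\<bar> \<le> C0 * d ^ N" .
    qed (use xy in auto)
    then show ?thesis by (simp add: algebra_simps)
  qed
  then show ?thesis using r0(1) C0(1) sub
    by (intro exI[of _ "real DIM('a) * C0"] exI[of _ r0]) auto
qed

text \<open>Taylor's theorem for a function whose Taylor polynomials all vanish, by induction on the order:
the partial derivatives are again flat, so they are \<open>O(dist a x ^ N)\<close>, and integrating them along the
segment from \<open>a\<close> gains one order.\<close>

lemma smooth_on_flat_bound:
  fixes f :: "'a::euclidean_space \<Rightarrow> real"
  assumes "open S" "a \<in> S" "smooth_on S f" "vanishes_to_infinite_order f a"
  shows "\<exists>C r. r > 0 \<and> C \<ge> 0 \<and> ball a r \<subseteq> S \<and> (\<forall>x\<in>ball a r. \<bar>f x\<bar> \<le> C * dist a x ^ N)"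
  using assms(3,4)
proof (induction N arbitrary: f)
  case 0
  have "f a = 0"
    using 0(2) unfolding vanishes_to_infinite_order_def
    by (metis bot.extremum iter_partial.simps(1) list.set(1))
  moreover have "isCont f a" using 0 assms smooth_on_imp_isCont by blast
  ultimately have "\<forall>\<^sub>F x in at a. dist (f x) 0 < 1"
    by (metis isCont_def tendstoD zero_less_one)
  then obtain d where d: "d > 0" "\<And>x. x \<noteq> a \<Longrightarrow> dist x a < d \<Longrightarrow> \<bar>f x\<bar> < 1"
    unfolding eventually_at by auto
  obtain e where e: "e > 0" "ball a e \<subseteq> S" using assms by (meson openE)
  have "\<forall>x\<in>ball a (min d e). \<bar>f x\<bar> \<le> 1 * dist a x ^ 0"
  proof
    fix x assume "x \<in> ball a (min d e)"
    then show "\<bar>f x\<bar> \<le> 1 * dist a x ^ 0"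
      using d(2)[of x] \<open>f a = 0\<close> by (cases "x = a") (auto simp: dist_commute)
  qed
  then show ?case using d e by (intro exI[of _ 1] exI[of _ "min d e"]) auto
next
  case (Suc N)
  have "\<exists>C r. r > 0 \<and> C \<ge> 0 \<and> ball a r \<subseteq> S \<and>
      (\<forall>x\<in>ball a r. \<bar>iter_partial [b] f x\<bar> \<le> C * dist a x ^ N)" if "b \<in> Basis" for b
  proof (rule Suc.IH)
    show "smooth_on S (iter_partial [b] f)"
      using that Suc.prems by (intro smooth_on_iter_partial) auto
    show "vanishes_to_infinite_order (iter_partial [b] f) a"
      using that Suc.prems unfolding vanishes_to_infinite_order_def iter_partial_append[symmetric]
      by auto
  qed
  then obtain C r where Cr: "r > 0" "C \<ge> 0" "ball a r \<subseteq> S"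
      "\<And>d x y. d < r \<Longrightarrow> x \<in> cball a d \<Longrightarrow> y \<in> cball a d \<Longrightarrow> \<bar>f x - f y\<bar> \<le> C * d ^ N * norm (x - y)"
    using smooth_on_lipschitz_of_partial_bounds[OF Suc.prems(1)] by metis
  have fa: "f a = 0"
    using Suc.prems(2) unfolding vanishes_to_infinite_order_def
    by (metis bot.extremum iter_partial.simps(1) list.set(1))
  have "\<bar>f x\<bar> \<le> C * dist a x ^ Suc N" if "x \<in> ball a r" for x
    using Cr(4)[of "dist a x" x a] that fa by (simp add: dist_norm norm_minus_commute algebra_simps)
  then show ?case using Cr by (intro exI[of _ C] exI[of _ r]) auto
qed

lemma smooth_on_flat_lipschitz:
  fixes f :: "'a::euclidean_space \<Rightarrow> real"
  assumes "open S" "a \<in> S" "smooth_on S f" "vanishes_to_infinite_order f a"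
  shows "\<exists>C r. r > 0 \<and> C \<ge> 0 \<and> ball a r \<subseteq> S \<and> (\<forall>d x y. d < r \<longrightarrow> x \<in> cball a d \<longrightarrow> y \<in> cball a d
           \<longrightarrow> \<bar>f x - f y\<bar> \<le> C * d ^ N * norm (x - y))"
proof (rule smooth_on_lipschitz_of_partial_bounds[OF assms(3)], rule smooth_on_flat_bound)
  fix b :: 'a assume "b \<in> Basis"
  then show "smooth_on S (iter_partial [b] f)"
    using assms by (intro smooth_on_iter_partial) auto
  show "vanishes_to_infinite_order (iter_partial [b] f) a"
    using \<open>b \<in> Basis\<close> assms unfolding vanishes_to_infinite_order_def iter_partial_append[symmetric]
    by auto
qed (use assms in auto)

lemma smooth_on_locally_lipschitz:
  fixes f :: "'a::euclidean_space \<Rightarrow> real"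
  assumes "open S" "a \<in> S" "smooth_on S f"
  shows "\<exists>C r. r > 0 \<and> (\<forall>x\<in>ball a r. \<forall>y\<in>ball a r. \<bar>f x - f y\<bar> \<le> C * norm (x - y))"
proof -
  have "\<forall>\<^sub>F x in nhds a. \<forall>b\<in>Basis. \<bar>iter_partial [b] f x\<bar> < \<bar>iter_partial [b] f a\<bar> + 1"
  proof (intro eventually_ball_finite finite_Basis ballI)
    fix b :: 'a assume "b \<in> Basis"
    then have "isCont (iter_partial [b] f) a"
      using smooth_on_imp_isCont[OF smooth_on_iter_partial[OF assms(3), of "[b]"] assms(2)] by simp
    then have "((\<lambda>x. \<bar>iter_partial [b] f x\<bar>) \<longlongrightarrow> \<bar>iter_partial [b] f a\<bar>) (nhds a)"
      unfolding isCont_def tendsto_at_iff_tendsto_nhds by (rule tendsto_rabs)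
    then show "\<forall>\<^sub>F x in nhds a. \<bar>iter_partial [b] f x\<bar> < \<bar>iter_partial [b] f a\<bar> + 1"
      by (rule order_tendstoD) simp
  qed
  then have "\<forall>\<^sub>F x in nhds a. x \<in> S \<and> (\<forall>b\<in>Basis. \<bar>iter_partial [b] f x\<bar> < \<bar>iter_partial [b] f a\<bar> + 1)"
    using assms by (intro eventually_conj eventually_nhds_in_open)
  then obtain r where r: "r > 0" "\<And>x. dist x a < r \<Longrightarrow> x \<in> S \<and>
      (\<forall>b\<in>Basis. \<bar>iter_partial [b] f x\<bar> < \<bar>iter_partial [b] f a\<bar> + 1)"
    unfolding eventually_nhds_metric by blast
  define K where "K = (\<Sum>b\<in>Basis. \<bar>iter_partial [b] f a\<bar> + 1)"
  have "\<bar>f x - f y\<bar> \<le> real DIM('a) * K * norm (x - y)" if "x \<in> ball a r" "y \<in> ball a r" for x y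
  proof (rule smooth_on_lipschitz[OF assms(3), of "ball a r"])
    show "ball a r \<subseteq> S" using r(2) by (auto simp: dist_commute)
    fix u b assume u: "u \<in> ball a r" and b: "b \<in> (Basis::'a set)"
    have "\<bar>iter_partial [b] f u\<bar> \<le> \<bar>iter_partial [b] f a\<bar> + 1"
      using r(2)[of u] u b by (auto simp: dist_commute intro: less_imp_le)
    also have "\<dots> \<le> K" unfolding K_def using b by (intro member_le_sum) auto
    finally show "\<bar>iter_partial [b] f u\<bar> \<le> K" .
  qed (use that in auto)
  then show ?thesis using r(1) by blast
qed

section \<open>Expansion of a holomorphic function in its first variable\<close>

definition fst_coeff :: "(complex \<Rightarrow> complex \<Rightarrow> complex) \<Rightarrow> nat \<Rightarrow> complex \<Rightarrow> complex" where
  "fst_coeff F j y = (deriv ^^ j) (\<lambda>x. F x y) 0 / fact j"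

lemma fst_coeff_0: "fst_coeff F 0 = F 0"
  by (simp add: fst_coeff_def fun_eq_iff)

text \<open>Cauchy's estimates bound the coefficients by \<open>K / r ^ j\<close> uniformly in \<open>y\<close>, so the tail of the
expansion is dominated by a geometric series.\<close>

lemma fst_coeff_remainder:
  assumes "r > 0" and hol: "\<And>y. y \<in> cball 0 r \<Longrightarrow> (\<lambda>x. F x y) holomorphic_on cball 0 r"
    and bd: "\<And>x y. x \<in> cball 0 r \<Longrightarrow> y \<in> cball 0 r \<Longrightarrow> cmod (F x y) < K"
    and x: "cmod x \<le> r / 2" and y: "y \<in> cball 0 r"
  shows "cmod (F x y - (\<Sum>j<n. fst_coeff F j y * x ^ j)) \<le> 2 * K / r ^ n * cmod x ^ n"
proof -
  let ?t = "\<lambda>j. fst_coeff F j y * x ^ j"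
  have "K > 0" using bd[of 0 y] y \<open>r > 0\<close> by (auto intro: le_less_trans[OF norm_ge_zero])
  have b0: "cmod (fst_coeff F j y) \<le> K / r ^ j" for j
  proof (cases "j = 0")
    case True
    then show ?thesis using bd[of 0 y] y \<open>r > 0\<close> by (simp add: fst_coeff_def less_imp_le)
  next
    case False
    have "cmod ((deriv ^^ j) (\<lambda>x. F x y) 0) \<le> fact j * K / r ^ j"
    proof (rule Cauchy_higher_deriv_bound[where y = 0])
      show "(\<lambda>x. F x y) holomorphic_on ball 0 r"
        using hol[OF y] by (rule holomorphic_on_subset) auto
      show "continuous_on (cball 0 r) (\<lambda>x. F x y)"
        using hol[OF y] by (rule holomorphic_on_imp_continuous_on)
    qed (use False bd y \<open>r > 0\<close> in auto)
    then show ?thesis by (simp add: fst_coeff_def norm_divide field_simps)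
  qed
  have q: "cmod x / r \<le> 1 / 2" "0 \<le> cmod x / r" using x \<open>r > 0\<close> by (auto simp: field_simps)
  have "?t sums F x y"
    using holomorphic_power_series[OF holomorphic_on_subset[OF hol[OF y] ball_subset_cball], of x] x \<open>r > 0\<close>
    by (simp add: fst_coeff_def)
  then have s1: "(\<lambda>j. ?t (j + n)) sums (F x y - (\<Sum>j<n. ?t j))"
    by (rule sums_split_initial_segment)
  have s2: "(\<lambda>j. K * (cmod x / r) ^ n * (cmod x / r) ^ j) sums (K * (cmod x / r) ^ n * (1 / (1 - cmod x / r)))"
    using q \<open>r > 0\<close> by (intro sums_mult geometric_sums) (auto simp: field_simps)
  have "cmod (F x y - (\<Sum>j<n. ?t j)) \<le> K * (cmod x / r) ^ n * (1 / (1 - cmod x / r))"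
  proof (rule norm_sums_le[OF s1 s2])
    fix j
    have "cmod (?t (j + n)) \<le> K / r ^ (j + n) * cmod x ^ (j + n)"
      unfolding norm_mult norm_power by (intro mult_right_mono b0) auto
    also have "\<dots> = K * (cmod x / r) ^ n * (cmod x / r) ^ j"
      by (simp add: power_add power_divide mult_ac)
    finally show "cmod (?t (j + n)) \<le> K * (cmod x / r) ^ n * (cmod x / r) ^ j" .
  qed
  also have "\<dots> \<le> K * (cmod x / r) ^ n * 2"
  proof (rule mult_left_mono)
    have "1 / (1 - t) \<le> 2" if "t \<le> 1 / 2" for t :: real
      using that by (simp add: field_simps)
    then show "1 / (1 - cmod x / r) \<le> 2" using q by blast
    show "0 \<le> K * (cmod x / r) ^ n"
      using q \<open>K > 0\<close> by (intro mult_nonneg_nonneg zero_le_power) auto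
  qed
  also have "\<dots> = 2 * K / r ^ n * cmod x ^ n"
    by (simp add: power_divide)
  finally show ?thesis .
qed

text \<open>Separate holomorphy and boundedness suffice: by the uniform remainder estimate the \<open>n\<close>-th coefficient is
the uniform limit, as \<open>x \<rightarrow> 0\<close>, of \<open>(F x y - (\<Sum>j<n. fst_coeff F j y * x ^ j)) / x ^ n\<close>, which is
holomorphic in \<open>y\<close> once the lower coefficients are.\<close>

lemma fst_coeff_holomorphic:
  assumes "r > 0" and hol: "\<And>y. y \<in> cball 0 r \<Longrightarrow> (\<lambda>x. F x y) holomorphic_on cball 0 r"
    and hol': "\<And>x. x \<in> cball 0 r \<Longrightarrow> (\<lambda>y. F x y) holomorphic_on cball 0 r"
    and bd: "\<And>x y. x \<in> cball 0 r \<Longrightarrow> y \<in> cball 0 r \<Longrightarrow> cmod (F x y) < K"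
  shows "fst_coeff F n holomorphic_on ball 0 r"
proof (induction n rule: less_induct)
  case (less n)
  \<comment> \<open>A sequence of nonzero points that tends to \<open>0\<close> inside the disc in which the remainder estimate holds.\<close>
  define X where "X = (\<lambda>k. complex_of_real (r / 2 / Suc k))"
  have X: "cmod (X k) = r / 2 / Suc k" "cmod (X k) \<le> r / 2" for k
    using \<open>r > 0\<close> unfolding X_def norm_of_real by (auto simp: field_simps)
  have X0: "X k \<noteq> 0" for k
    using X(1)[of k] \<open>r > 0\<close> by auto
  define G where "G = (\<lambda>k y. (F (X k) y - (\<Sum>j<n. fst_coeff F j y * X k ^ j)) / X k ^ n)"
  define D where "D = 2 * K / r ^ Suc n"
  have err: "cmod (G k y - fst_coeff F n y) \<le> D * (r / 2 / Suc k)" if "y \<in> cball 0 r" for k y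
  proof -
    have "G k y - fst_coeff F n y = (F (X k) y - (\<Sum>j<Suc n. fst_coeff F j y * X k ^ j)) / X k ^ n"
      using X0[of k] by (simp add: G_def field_simps)
    also have "cmod \<dots> \<le> D * cmod (X k) ^ Suc n / cmod (X k) ^ n"
      unfolding norm_divide norm_power D_def
      by (intro divide_right_mono fst_coeff_remainder[OF \<open>r > 0\<close> hol bd]) (use X(2) that in \<open>auto intro: zero_le_power\<close>)
    also have "\<dots> = D * (r / 2 / Suc k)" using X0[of k] unfolding X(1)[symmetric] by simp
    finally show ?thesis .
  qed
  have lim: "(\<lambda>k. D * (r / 2 / Suc k)) \<longlonglongrightarrow> 0"
    by (intro tendsto_mult_right_zero LIMSEQ_Suc[OF lim_const_over_n])
  have ul: "uniform_limit (ball 0 r) G (fst_coeff F n) sequentially"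
    unfolding uniform_limit_iff
  proof (intro allI impI)
    fix e :: real assume "e > 0"
    with lim have "\<forall>\<^sub>F k in sequentially. D * (r / 2 / Suc k) < e" by (rule order_tendstoD)
    then show "\<forall>\<^sub>F k in sequentially. \<forall>y\<in>ball 0 r. dist (G k y) (fst_coeff F n y) < e"
      by eventually_elim (auto simp: dist_norm intro: le_less_trans[OF err])
  qed
  show ?case
  proof (rule holomorphic_uniform_sequence[OF open_ball])
    fix k
    have "(\<lambda>y. F (X k) y) holomorphic_on ball 0 r"
      using hol'[of "X k"] X(2)[of k] \<open>r > 0\<close> by (auto intro: holomorphic_on_subset)
    then show "G k holomorphic_on ball 0 r"
      unfolding G_def using X0[of k] by (intro holomorphic_intros less.IH) auto
  next
    fix x :: complex assume "x \<in> ball 0 r"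
    then obtain d where "d > 0" "cball x d \<subseteq> ball 0 r"
      by (meson open_ball open_contains_cball)
    then show "\<exists>d>0. cball x d \<subseteq> ball 0 r \<and> uniform_limit (cball x d) G (fst_coeff F n) sequentially"
      using uniform_limit_on_subset[OF ul] by blast
  qed
qed

text \<open>A function of one variable is regarded as a function of two variables that is constant in the second.\<close>

lemma holomorphic_taylor_bigo:
  assumes "r > 0" "f holomorphic_on ball 0 r"
  shows "(\<lambda>y. f y - (\<Sum>j<n. (deriv ^^ j) f 0 / fact j * y ^ j)) \<in> O[at 0](\<lambda>y. y ^ n)"
proof -
  have hol: "f holomorphic_on cball 0 (r / 2)"
    using assms by (auto intro: holomorphic_on_subset)
  obtain K where K: "\<And>x. x \<in> cball 0 (r / 2) \<Longrightarrow> cmod (f x) < K"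
  proof -
    have "compact (f ` cball 0 (r / 2))"
      by (intro compact_continuous_image holomorphic_on_imp_continuous_on hol) auto
    then obtain B where "\<forall>x\<in>f ` cball 0 (r / 2). norm x \<le> B"
      using compact_imp_bounded bounded_iff by metis
    then show ?thesis using that[of "B + 1"]
      by (metis image_eqI less_add_one order_le_less_trans)
  qed
  have "\<forall>\<^sub>F y in at 0. cmod (f y - (\<Sum>j<n. (deriv ^^ j) f 0 / fact j * y ^ j)) \<le> 2 * K / (r / 2) ^ n * cmod (y ^ n)"
    unfolding eventually_at
  proof (intro exI[of _ "r / 4"] conjI ballI impI)
    fix y :: complex assume "y \<noteq> 0 \<and> dist y 0 < r / 4"
    then have "cmod (f y - (\<Sum>j<n. fst_coeff (\<lambda>x y. f x) j 0 * y ^ j)) \<le> 2 * K / (r / 2) ^ n * cmod y ^ n"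
      by (intro fst_coeff_remainder[where F = "\<lambda>x y. f x"]) (use assms hol K in auto)
    then show "cmod (f y - (\<Sum>j<n. (deriv ^^ j) f 0 / fact j * y ^ j)) \<le> 2 * K / (r / 2) ^ n * cmod (y ^ n)"
      by (simp only: norm_power fst_coeff_def)
  qed (use assms in auto)
  then show ?thesis by (rule bigoI)
qed

lemma holomorphic_leading_term:
  assumes "r > 0" "f holomorphic_on ball 0 r" "\<not> (\<forall>y\<in>ball 0 r. f y = 0)"
  obtains m c where "c \<noteq> 0" "c = (deriv ^^ m) f 0 / fact m"
    "(\<lambda>y. f y - c * y ^ m) \<in> O[at 0](\<lambda>y. y ^ Suc m)"
proof -
  have "\<exists>m. (deriv ^^ m) f 0 \<noteq> 0"
    using holomorphic_fun_eq_0_on_ball[OF assms(2)] assms(3) by metis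
  then obtain m where m: "(deriv ^^ m) f 0 \<noteq> 0" "\<forall>j<m. \<not> (deriv ^^ j) f 0 \<noteq> 0"
    using exists_least_iff[of "\<lambda>m. (deriv ^^ m) f 0 \<noteq> 0"] by blast
  then have "(\<Sum>j<Suc m. (deriv ^^ j) f 0 / fact j * y ^ j) = (deriv ^^ m) f 0 / fact m * y ^ m" for y
    by simp
  with holomorphic_taylor_bigo[OF assms(1,2), of "Suc m"] m(1) show ?thesis
    by (intro that[of "(deriv ^^ m) f 0 / fact m" m]) simp_all
qed

section \<open>Flat functions are not comparable with a power along small steps\<close>

lemma flat_quotient_small:
  fixes p :: "real \<Rightarrow> real"
  assumes flat: "p \<in> O[at_right 0](\<lambda>s. s ^ Suc N)" and "e > 0"
  shows "\<forall>\<^sub>F s in at_right 0. p s / s ^ N < e"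
proof -
  obtain c where "c > 0" and c: "\<forall>\<^sub>F s in at_right 0. norm (p s) \<le> c * norm (s ^ Suc N)"
    using flat by (rule landau_o.bigE)
  have "\<forall>\<^sub>F s in at_right 0. s \<in> {0<..<e / c}"
    using \<open>e > 0\<close> \<open>c > 0\<close> by (intro eventually_at_right_real) simp
  with c show ?thesis
  proof eventually_elim
    case (elim s)
    then have "p s \<le> (c * s) * s ^ N" "0 < s" "c * s < e" using \<open>c > 0\<close>
      by (auto simp: field_simps abs_mult power_abs)
    then have "p s / s ^ N \<le> c * s" by (simp add: field_simps)
    then show ?case using \<open>c * s < e\<close> by linarith
  qed
qed

text \<open>The least maximiser of \<open>p s / s ^ N\<close> on \<open>[\<eta>, d]\<close> cannot be followed by a step down that does not
decrease this quotient: a step inside the interval contradicts minimality, and below \<open>\<eta>\<close> the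
quotient is smaller than its value at \<open>d\<close>.\<close>

lemma flat_no_descent:
  fixes p :: "real \<Rightarrow> real"
  assumes "d > 0" and cont: "continuous_on {0<..d} p" and pos: "\<And>s. 0 < s \<Longrightarrow> s \<le> d \<Longrightarrow> p s > 0"
    and flat: "p \<in> O[at_right 0](\<lambda>s. s ^ Suc N)"
    and step: "\<And>s. 0 < s \<Longrightarrow> s \<le> d \<Longrightarrow> \<exists>s'. 0 < s' \<and> s' < s \<and> p s' \<ge> p s * (s' / s) ^ N"
  shows False
proof -
  define G where "G = (\<lambda>s. p s / s ^ N)"
  have contG: "continuous_on {0<..d} G"
    unfolding G_def by (intro continuous_intros cont) auto
  have "G d > 0" unfolding G_def using pos[of d] \<open>d > 0\<close> by simp
  have "\<forall>\<^sub>F s in at_right 0. G s < G d"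
    unfolding G_def by (rule flat_quotient_small[OF flat]) (use \<open>G d > 0\<close> in \<open>simp add: G_def\<close>)
  then obtain b where b: "b > 0" "\<And>s. 0 < s \<Longrightarrow> s < b \<Longrightarrow> G s < G d"
    by (auto simp: eventually_at_right_field)
  define \<eta> where "\<eta> = min (b / 2) d"
  have \<eta>: "0 < \<eta>" "\<eta> \<le> d" "\<eta> < b" unfolding \<eta>_def using b \<open>d > 0\<close> by auto
  have contG': "continuous_on {\<eta>..d} G" using contG by (rule continuous_on_subset) (use \<eta> in auto)
  obtain m where m: "m \<in> {\<eta>..d}" "\<And>s. s \<in> {\<eta>..d} \<Longrightarrow> G s \<le> G m"
    using continuous_attains_sup[OF _ _ contG'] \<eta> by auto
  define A where "A = {\<eta>..d} \<inter> G -` {G m..}"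
  have "closed A" unfolding A_def by (rule continuous_closed_preimage[OF contG']) auto
  then have "compact ({\<eta>..d} \<inter> A)" by (intro compact_Int_closed) auto
  then have "compact A" by (simp add: A_def)
  moreover have "m \<in> A" using m by (simp add: A_def)
  ultimately obtain s where s: "s \<in> A" "\<And>t. t \<in> A \<Longrightarrow> s \<le> t"
    using compact_attains_inf[of A] by blast
  then have s0: "0 < s" "s \<le> d" "G s \<ge> G m" using \<eta> by (auto simp: A_def)
  then obtain s' where s': "0 < s'" "s' < s" "p s' \<ge> p s * (s' / s) ^ N" using step by blast
  then have le: "G s \<le> G s'" using s0 unfolding G_def by (simp add: field_simps)
  show False
  proof (cases "s' \<ge> \<eta>")
    case True
    then have "s' \<in> A" using le s0 s' by (auto simp: A_def)
    then show False using s s' by force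
  next
    case False
    then have "G s' < G d" using b s' \<eta> by auto
    also have "\<dots> \<le> G m" using m \<eta> by auto
    finally show False using le s0 by simp
  qed
qed

text \<open>The dual argument with the greatest minimiser of \<open>p s / s ^ N\<close> on \<open>[\<eta>, d]\<close>. A step up may leave this
interval, but only into \<open>[d, D * d]\<close>, where the quotient is bounded below by a positive number; \<open>\<eta>\<close> is
chosen such that the quotient at \<open>\<eta>\<close> is smaller than that bound.\<close>

lemma flat_no_ascent:
  fixes p :: "real \<Rightarrow> real"
  assumes "d > 0" "D \<ge> 1" and cont: "continuous_on {0<..D * d} p"
    and pos: "\<And>s. 0 < s \<Longrightarrow> s \<le> D * d \<Longrightarrow> p s > 0"
    and flat: "p \<in> O[at_right 0](\<lambda>s. s ^ Suc N)"
    and step: "\<And>s. 0 < s \<Longrightarrow> s \<le> d \<Longrightarrow> \<exists>s'. s < s' \<and> s' \<le> D * s \<and> p s' \<le> p s * (s' / s) ^ N"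
  shows False
proof -
  define G where "G = (\<lambda>s. p s / s ^ N)"
  have dD: "d \<le> D * d" using assms by simp
  have contG: "continuous_on {0<..D * d} G"
    unfolding G_def by (intro continuous_intros cont) auto
  have "continuous_on {d..D * d} G"
    using contG by (rule continuous_on_subset) (use \<open>d > 0\<close> in auto)
  then obtain x where x: "x \<in> {d..D * d}" "\<And>s. s \<in> {d..D * d} \<Longrightarrow> G x \<le> G s"
    using continuous_attains_inf[of "{d..D * d}" G] dD by auto
  have "G x > 0" unfolding G_def using pos[of x] x(1) \<open>d > 0\<close> by simp
  have "\<forall>\<^sub>F s in at_right 0. G s < G x"
    unfolding G_def by (rule flat_quotient_small[OF flat]) (use \<open>G x > 0\<close> in \<open>simp add: G_def\<close>)
  then obtain b where b: "b > 0" "\<And>s. 0 < s \<Longrightarrow> s < b \<Longrightarrow> G s < G x"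
    by (auto simp: eventually_at_right_field)
  define \<eta> where "\<eta> = min (b / 2) d"
  have \<eta>: "0 < \<eta>" "\<eta> \<le> d" "\<eta> < b" unfolding \<eta>_def using b \<open>d > 0\<close> by auto
  have "{\<eta>..d} \<subseteq> {0<..D * d}"
    using \<eta>(1) dD by (meson atLeastAtMost_iff greaterThanAtMost_iff less_le_trans order_trans subsetI)
  with contG have contG': "continuous_on {\<eta>..d} G" by (rule continuous_on_subset)
  obtain m where m: "m \<in> {\<eta>..d}" "\<And>s. s \<in> {\<eta>..d} \<Longrightarrow> G m \<le> G s"
    using continuous_attains_inf[OF _ _ contG'] \<eta> by auto
  define A where "A = {\<eta>..d} \<inter> G -` {..G m}"
  have "closed A" unfolding A_def by (rule continuous_closed_preimage[OF contG']) auto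
  then have "compact ({\<eta>..d} \<inter> A)" by (intro compact_Int_closed) auto
  then have "compact A" by (simp add: A_def)
  moreover have "m \<in> A" using m by (simp add: A_def)
  ultimately obtain s where s: "s \<in> A" "\<And>t. t \<in> A \<Longrightarrow> t \<le> s"
    using compact_attains_sup[of A] by blast
  then have s0: "0 < s" "s \<le> d" "G s \<le> G m" using \<eta> by (auto simp: A_def)
  then obtain s' where s': "s < s'" "s' \<le> D * s" "p s' \<le> p s * (s' / s) ^ N" using step by blast
  then have le: "G s' \<le> G s" using s0 unfolding G_def by (simp add: field_simps)
  show False
  proof (cases "s' \<le> d")
    case True
    then have "s' \<in> A" using le s0 s' s by (auto simp: A_def)
    then show False using s s' by force
  next
    case False
    have "s' \<le> D * d" using s'(2) s0 \<open>D \<ge> 1\<close> by (meson dual_order.trans mult_left_mono order_trans zero_le_one)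
    then have "G x \<le> G s'" using x False by auto
    moreover have "G m \<le> G \<eta>" "G \<eta> < G x" using m b \<eta> by auto
    ultimately show False using le s0 by simp
  qed
qed

text \<open>A large power has a large slope at \<open>1\<close>, so just to the left of \<open>1\<close> it lies below any
given line through \<open>(1, 1)\<close>.
Bernoulli's inequality for \<open>1 / x\<close> makes this explicit.\<close>

lemma power_le_linear:
  fixes K :: real
  assumes "K > 0"
  shows "\<exists>N \<eta>. \<eta> > 0 \<and> (\<forall>x. 1 - \<eta> < x \<and> x \<le> 1 \<longrightarrow> x ^ N \<le> 1 - K * (1 - x))"
proof -
  obtain N :: nat where N: "2 * K \<le> real N" using real_arch_simple by blast
  define \<eta> where "\<eta> = min (1 / 2) (1 / (2 * K))"
  have "x ^ N \<le> 1 - K * (1 - x)" if x: "1 - \<eta> < x" "x \<le> 1" for x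
  proof -
    define y where "y = 1 - x"
    have y: "0 \<le> y" "y < 1 / 2" "y < 1 / (2 * K)" using x by (auto simp: y_def \<eta>_def)
    have Ky: "K * y < 1 / 2" using y(3) \<open>K > 0\<close> by (simp add: field_simps)
    have "(1 + y) * x = 1 - y * y" by (simp add: y_def algebra_simps)
    then have "(1 + y) * x \<le> 1" by simp
    moreover have "x > 0" using y by (simp add: y_def)
    ultimately have inv: "1 / x \<ge> 1 + y" by (simp add: pos_le_divide_eq)
    have "1 + 2 * K * y \<le> 1 + real N * y" using N y by (intro add_left_mono mult_right_mono) auto
    also have "\<dots> \<le> (1 + y) ^ N" using y by (intro Bernoulli_inequality) auto
    also have "\<dots> \<le> (1 / x) ^ N" using inv y by (intro power_mono) auto
    finally have 1: "(1 + 2 * K * y) * x ^ N \<le> 1"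
      using \<open>x > 0\<close> by (simp add: power_one_over pos_le_divide_eq)
    have "1 \<le> (1 + 2 * K * y) * (1 - K * y)"
    proof -
      have "(1 + 2 * K * y) * (1 - K * y) - 1 = (K * y) * (1 - 2 * (K * y))" by (simp add: algebra_simps)
      moreover have "(K * y) * (1 - 2 * (K * y)) \<ge> 0" using Ky y \<open>K > 0\<close> by (intro mult_nonneg_nonneg) auto
      ultimately show ?thesis by linarith
    qed
    with 1 have "(1 + 2 * K * y) * x ^ N \<le> (1 + 2 * K * y) * (1 - K * y)" by linarith
    moreover have "1 + 2 * K * y > 0" using y \<open>K > 0\<close> by (intro add_pos_nonneg mult_nonneg_nonneg) auto
    ultimately have "x ^ N \<le> 1 - K * y" by (metis mult_le_cancel_left_pos)
    then show ?thesis by (simp add: y_def)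
  qed
  moreover have "\<eta> > 0" using \<open>K > 0\<close> by (simp add: \<eta>_def)
  ultimately show ?thesis by blast
qed

section \<open>Landau symbols at the origin\<close>

lemma bigo_Re: "h \<in> O[F](g) \<Longrightarrow> (\<lambda>x. complex_of_real (Re (h x))) \<in> O[F](g)"
  by (erule landau_o.big_trans[rotated]) (auto intro!: bigoI[where c = 1] always_eventually simp: abs_Re_le_cmod)

lemma bigo_Im: "h \<in> O[F](g) \<Longrightarrow> (\<lambda>x. complex_of_real (Im (h x))) \<in> O[F](g)"
  by (erule landau_o.big_trans[rotated]) (auto intro!: bigoI[where c = 1] always_eventually simp: abs_Im_le_cmod)

lemma power_bigo_power_at_0:
  assumes "j \<le> k"
  shows "(\<lambda>z::complex. z ^ k) \<in> O[at 0](\<lambda>z. z ^ j)"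
proof (rule bigoI[where c = 1])
  have "\<forall>\<^sub>F z::complex in at 0. cmod z < 1"
    unfolding eventually_at by (intro exI[of _ 1]) auto
  then show "\<forall>\<^sub>F z::complex in at 0. cmod (z ^ k) \<le> 1 * cmod (z ^ j)"
    by eventually_elim (use assms in \<open>simp add: norm_power power_decreasing\<close>)
qed

lemma bigo_power_diff:
  fixes X Y :: "'a \<Rightarrow> complex"
  assumes "X \<in> O[F](\<lambda>_. 1)" "Y \<in> O[F](\<lambda>_. 1)" "(\<lambda>z. X z - Y z) \<in> O[F](h)"
  shows "(\<lambda>z. X z ^ k - Y z ^ k) \<in> O[F](h)"
proof (induction k)
  case (Suc k)
  have "Y \<in> O[F](\<lambda>_. 1) \<Longrightarrow> (\<lambda>z. Y z ^ k) \<in> O[F](\<lambda>_. 1)"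
    by (drule landau_o.big_power[where m = k]) simp
  then have "(\<lambda>z. X z * (X z ^ k - Y z ^ k) + (X z - Y z) * Y z ^ k) \<in> O[F](h)"
    using landau_o.big.mult[OF assms(1) Suc] landau_o.big.mult[OF assms(3), of "\<lambda>z. Y z ^ k" "\<lambda>_. 1"] assms(2)
    by (intro sum_in_bigo) auto
  then show ?case by (simp add: algebra_simps)
qed simp

lemma bigo_at_0_imp_tendsto_0:
  fixes h :: "complex \<Rightarrow> complex"
  assumes "h \<in> O[at 0](\<lambda>z. z)"
  shows "(h \<longlongrightarrow> 0) (at 0)"
proof -
  obtain c where c: "\<forall>\<^sub>F z in at 0. cmod (h z) \<le> c * cmod z" using assms by (rule landau_o.bigE)
  have "((\<lambda>z::complex. c * cmod z) \<longlongrightarrow> 0) (at 0)" by (intro tendsto_eq_intros) auto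
  then show ?thesis by (rule Lim_null_comparison[OF c])
qed

lemma Re_of_real_mult: "Re (of_real a * w) = a * Re w"
  by simp

section \<open>The hypersurface\<close>

text \<open>The data and the hypotheses of the theorem: the germ at \<open>0\<close> of the real hypersurface
\<open>Re z1 + P z2 + Im z1 * Q (z2, Im z1) = 0\<close>. It is of infinite type at \<open>0\<close> because \<open>P\<close> is flat.\<close>

locale infinite_type_hypersurface =
  fixes P :: "complex \<Rightarrow> real" and Q :: "complex \<times> real \<Rightarrow> real" and \<epsilon> \<delta> :: real
  assumes eps: "\<epsilon> > 0" and del: "\<delta> > 0"
    and P_smooth: "smooth_on {z. cmod z < \<epsilon>} P"
    and Q_smooth: "smooth_on ({z. cmod z < \<epsilon>} \<times> {-\<delta><..<\<delta>}) Q"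
    and P_0: "P 0 = 0" and Q_0: "Q (0, 0) = 0"
    and P_radial: "\<And>z. cmod z < \<epsilon> \<Longrightarrow> P z = P (of_real (cmod z))"
    and Q_radial: "\<And>z t. cmod z < \<epsilon> \<Longrightarrow> t \<in> {-\<delta><..<\<delta>} \<Longrightarrow> Q (z, t) = Q (of_real (cmod z), t)"
    and P_pos: "\<And>z. cmod z < \<epsilon> \<Longrightarrow> z \<noteq> 0 \<Longrightarrow> P z > 0"
    and P_flat: "vanishes_to_infinite_order P 0"
begin

definition M :: "(complex \<times> complex) set" where
  "M = {(z1, z2). cmod z2 < \<epsilon> \<and> Im z1 \<in> {-\<delta><..<\<delta>} \<and>
         Re z1 + P z2 + Im z1 * Q (z2, Im z1) = 0}"

abbreviation p :: "complex \<Rightarrow> complex" where "p z \<equiv> of_real (P z)"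

lemma open_disc: "open {z. cmod z < \<epsilon>}"
  by (simp add: open_Collect_less continuous_on_norm_id)

lemma open_Q_dom: "open ({z. cmod z < \<epsilon>} \<times> {-\<delta><..<\<delta>})"
  by (intro open_Times open_disc) auto

lemma p_bigo: "p \<in> O[at 0](\<lambda>z. z ^ N)"
proof -
  obtain C r where "r > 0" "\<forall>x\<in>ball 0 r. \<bar>P x\<bar> \<le> C * dist 0 x ^ N"
    using smooth_on_flat_bound[OF open_disc _ P_smooth P_flat, of N] eps by auto
  then have "\<forall>\<^sub>F z in at 0. cmod (p z) \<le> C * cmod (z ^ N)"
    unfolding eventually_at by (intro exI[of _ r]) (auto simp: norm_power)
  then show ?thesis by (rule bigoI)
qed

lemma eventually_small: "e > 0 \<Longrightarrow> \<forall>\<^sub>F z::complex in at 0. z \<noteq> 0 \<and> cmod z < e"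
  unfolding eventually_at by (intro exI[of _ e]) auto

lemma isCont_P: "cmod z < \<epsilon> \<Longrightarrow> isCont P z"
  using smooth_on_imp_isCont[OF P_smooth] by auto

lemma isCont_Q: "cmod z < \<epsilon> \<Longrightarrow> \<bar>t\<bar> < \<delta> \<Longrightarrow> isCont Q (z, t)"
  using smooth_on_imp_isCont[OF Q_smooth, of "(z, t)"] by (auto simp: abs_less_iff)

text \<open>The Lipschitz constant of \<open>P\<close> on the disc of radius \<open>O(z)\<close> is \<open>O(z ^ N)\<close>, as the gradient of \<open>P\<close>
is flat too.\<close>

lemma P_diff_bigo:
  assumes "a \<in> O[at 0](\<lambda>z. z)" "(\<lambda>z. a z - z) \<in> O[at 0](h)"
  shows "(\<lambda>z. p (a z) - p z) \<in> O[at 0](\<lambda>z. z ^ N * h z)"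
proof -
  obtain C r where r: "r > 0" "C \<ge> 0" and lip: "\<And>d x y. d < r \<Longrightarrow> x \<in> cball 0 d \<Longrightarrow> y \<in> cball 0 d
           \<Longrightarrow> \<bar>P x - P y\<bar> \<le> C * d ^ N * norm (x - y)"
    using smooth_on_flat_lipschitz[OF open_disc _ P_smooth P_flat, of N] eps by auto
  obtain c where c: "c > 0" "\<forall>\<^sub>F z in at 0. cmod (a z) \<le> c * cmod z" using assms(1) by (rule landau_o.bigE)
  define D where "D = max c 1"
  have "r / D > 0" using r by (auto simp: D_def intro!: divide_pos_pos)
  have "\<forall>\<^sub>F z in at 0. cmod (p (a z) - p z) \<le> (C * D ^ N) * cmod (z ^ N * (a z - z))"
    using c(2) eventually_small[OF \<open>r / D > 0\<close>]
  proof eventually_elim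
    case (elim z)
    have "D \<ge> 1" "c \<le> D" by (auto simp: D_def)
    have "\<bar>P (a z) - P z\<bar> \<le> C * (D * cmod z) ^ N * norm (a z - z)"
    proof (rule lip)
      show "D * cmod z < r" using elim \<open>D \<ge> 1\<close> r by (simp add: field_simps)
      show "a z \<in> cball 0 (D * cmod z)"
        using elim \<open>c \<le> D\<close> by (auto intro: order_trans mult_right_mono)
      show "z \<in> cball 0 (D * cmod z)" using \<open>D \<ge> 1\<close> by (simp add: mult_le_cancel_right1)
    qed
    then show ?case
      by (simp add: norm_mult norm_power power_mult_distrib mult_ac flip: of_real_diff)
  qed
  then have "(\<lambda>z. p (a z) - p z) \<in> O[at 0](\<lambda>z. z ^ N * (a z - z))" by (rule bigoI)
  also have "(\<lambda>z. z ^ N * (a z - z)) \<in> O[at 0](\<lambda>z. z ^ N * h z)"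
    using assms(2) by (intro landau_o.big.mult) auto
  finally show ?thesis .
qed

lemma Q_diff_bigo:
  assumes "(a \<longlongrightarrow> 0) (at 0)" "(b \<longlongrightarrow> 0) (at 0)" "(t \<longlongrightarrow> 0) (at 0)" "(u \<longlongrightarrow> 0) (at 0)"
    and "(\<lambda>z. a z - b z) \<in> O[at 0](h)" "(\<lambda>z. complex_of_real (t z - u z)) \<in> O[at 0](h)"
  shows "(\<lambda>z. complex_of_real (Q (a z, t z) - Q (b z, u z))) \<in> O[at 0](h)"
proof -
  obtain C r where r: "r > 0" and lip: "\<forall>x\<in>ball (0, 0) r. \<forall>y\<in>ball (0, 0) r. \<bar>Q x - Q y\<bar> \<le> C * norm (x - y)"
    using smooth_on_locally_lipschitz[OF open_Q_dom _ Q_smooth, of "(0, 0)"] eps del by auto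
  have "((\<lambda>z. (a z, t z)) \<longlongrightarrow> (0, 0)) (at 0)" "((\<lambda>z. (b z, u z)) \<longlongrightarrow> (0, 0)) (at 0)"
    by (intro tendsto_Pair assms)+
  then have "\<forall>\<^sub>F z in at 0. dist (a z, t z) (0, 0) < r" "\<forall>\<^sub>F z in at 0. dist (b z, u z) (0, 0) < r"
    using r by (auto dest: tendstoD)
  then have "\<forall>\<^sub>F z in at 0. cmod (complex_of_real (Q (a z, t z) - Q (b z, u z)))
      \<le> \<bar>C\<bar> * norm (cmod (a z - b z) + cmod (complex_of_real (t z - u z)))"
  proof eventually_elim
    case (elim z)
    then have "(a z, t z) \<in> ball (0, 0) r" "(b z, u z) \<in> ball (0, 0) r"
      by (simp_all only: mem_ball dist_commute)
    then have "\<bar>Q (a z, t z) - Q (b z, u z)\<bar> \<le> C * norm ((a z, t z) - (b z, u z))"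
      using lip by blast
    also have "\<dots> \<le> \<bar>C\<bar> * (norm (a z - b z) + norm (t z - u z))"
      using norm_Pair_le[of "a z - b z" "t z - u z"] by (intro mult_mono) auto
    finally show ?case unfolding norm_of_real by simp
  qed
  then have "(\<lambda>z. norm (complex_of_real (Q (a z, t z) - Q (b z, u z))))
      \<in> O[at 0](\<lambda>z. cmod (a z - b z) + cmod (complex_of_real (t z - u z)))"
    by (intro bigoI) simp
  also have "(\<lambda>z. cmod (a z - b z) + cmod (complex_of_real (t z - u z))) \<in> O[at 0](\<lambda>z. norm (h z))"
    by (intro sum_in_bigo) (use assms(5,6) in \<open>simp_all only: landau_o.big.norm_iff\<close>)
  finally show ?thesis by (simp only: landau_o.big.norm_iff)
qed

lemma P_real_bigo: "(\<lambda>s. P (of_real s)) \<in> O[at_right 0](\<lambda>s. s ^ N)"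
proof -
  have "filterlim complex_of_real (at 0) (at_right 0)"
    unfolding filterlim_at by (auto intro!: tendsto_eq_intros simp: eventually_at_right_field intro: exI[of _ 1])
  from landau_o.big.compose[OF p_bigo[of N] this]
  have "(\<lambda>s. complex_of_real (P (of_real s))) \<in> O[at_right 0](\<lambda>s. complex_of_real (s ^ N))"
    by (simp only: of_real_power)
  then show ?thesis by (simp only: landau_o.big.of_real_iff)
qed

lemma continuous_on_P_real: "continuous_on {0<..<\<epsilon>} (\<lambda>s. P (of_real s))"
proof (rule continuous_at_imp_continuous_on, rule ballI)
  fix s assume "s \<in> {0<..<\<epsilon>}"
  then have "isCont P (of_real s)" by (intro isCont_P) auto
  then show "isCont (\<lambda>s. P (of_real s)) s" 
    by (rule isCont_o2[where g = P, rotated]) (auto intro: continuous_intros)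
qed

text \<open>By radial symmetry the one-dimensional obstruction applies to \<open>s' = cmod w\<close>.\<close>

lemma no_descent:
  assumes "\<forall>\<^sub>F s in at_right 0. \<exists>w. 0 < cmod w \<and> cmod w < s \<and> P w \<ge> P (of_real s) * (cmod w / s) ^ N"
  shows False
proof -
  obtain b where b: "b > 0" "\<And>s. 0 < s \<Longrightarrow> s < b \<Longrightarrow>
      \<exists>w. 0 < cmod w \<and> cmod w < s \<and> P w \<ge> P (of_real s) * (cmod w / s) ^ N"
    using assms unfolding eventually_at_right_field by blast
  define d where "d = min b \<epsilon> / 2"
  have d: "0 < d" "d < b" "d < \<epsilon>" using b eps by (auto simp: d_def min_def)
  show False
  proof (rule flat_no_descent[of d "\<lambda>s. P (of_real s)" N])
    show "continuous_on {0<..d} (\<lambda>s. P (complex_of_real s))"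
      using continuous_on_P_real by (rule continuous_on_subset) (use d in auto)
    fix s assume s: "0 < s" "s \<le> d"
    show "0 < P (complex_of_real s)" using s d by (intro P_pos) auto
    have "s < b" using s d by linarith
    with b(2) s obtain w where w: "0 < cmod w" "cmod w < s" "P w \<ge> P (of_real s) * (cmod w / s) ^ N"
      by blast
    then show "\<exists>s'>0. s' < s \<and> P (complex_of_real s) * (s' / s) ^ N \<le> P (complex_of_real s')"
      using P_radial[of w] s d by (intro exI[of _ "cmod w"]) auto
  qed (rule d, rule P_real_bigo)
qed

lemma no_ascent:
  assumes "\<forall>\<^sub>F s in at_right 0. \<exists>w. s < cmod w \<and> cmod w \<le> D * s \<and> P w \<le> P (of_real s) * (cmod w / s) ^ N"
  shows False
proof -
  obtain b where b: "b > 0" "\<And>s. 0 < s \<Longrightarrow> s < b \<Longrightarrow>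
      \<exists>w. s < cmod w \<and> cmod w \<le> D * s \<and> P w \<le> P (of_real s) * (cmod w / s) ^ N"
    using assms unfolding eventually_at_right_field by blast
  have "D > 1"
  proof -
    obtain w where "b / 2 < cmod w" "cmod w \<le> D * (b / 2)"
      using b(1) b(2)[of "b / 2"] half_gt_zero[OF b(1)] by (metis field_sum_of_halves less_add_same_cancel1)
    moreover have "D * (b / 2) \<le> 1 * (b / 2)" if "D \<le> 1"
      using that b(1) by (intro mult_right_mono) auto
    ultimately show ?thesis by linarith
  qed
  define d where "d = min b (\<epsilon> / D) / 2"
  have "d \<le> \<epsilon> / D / 2" "0 < \<epsilon> / D" using eps \<open>D > 1\<close> by (auto simp: d_def)
  then have "D * d \<le> D * (\<epsilon> / D / 2)" using \<open>D > 1\<close> by (intro mult_left_mono) auto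
  also have "\<dots> < \<epsilon>" using eps \<open>D > 1\<close> by simp
  finally have d: "0 < d" "d < b" "D * d < \<epsilon>"
    using b \<open>0 < \<epsilon> / D\<close> by (auto simp: d_def min_def)
  show False
  proof (rule flat_no_ascent[of d D "\<lambda>s. P (of_real s)" N])
    show "continuous_on {0<..D * d} (\<lambda>s. P (complex_of_real s))"
      using continuous_on_P_real by (rule continuous_on_subset) (use d in auto)
    show "0 < P (complex_of_real s)" if "0 < s" "s \<le> D * d" for s
      using d that by (intro P_pos) auto
    fix s assume s: "0 < s" "s \<le> d"
    then have "s < b" using d by linarith
    with b(2) s obtain w where w: "s < cmod w" "cmod w \<le> D * s" "P w \<le> P (of_real s) * (cmod w / s) ^ N"
      by blast
    have "D * s \<le> D * d" using s \<open>D > 1\<close> by simp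
    then have "cmod w < \<epsilon>" using w d by linarith
    then show "\<exists>s'>s. s' \<le> D * s \<and> P (complex_of_real s') \<le> P (complex_of_real s) * (s' / s) ^ N"
      using P_radial[of w] w by (intro exI[of _ "cmod w"]) auto
  qed (rule d, rule less_imp_le, rule \<open>D > 1\<close>, rule P_real_bigo)
qed

text \<open>If \<open>x = (cmod w / s)\<^sup>2\<close> stays on one side of \<open>1\<close> and the relative change of \<open>P\<close> is at most
\<open>K * \<bar>x - 1\<bar>\<close>, then \<open>P\<close> changes at most as much as a power of \<open>x\<close>: this is a forbidden descent for
\<open>x < 1\<close> and a forbidden ascent for \<open>x > 1\<close>.\<close>

lemma no_radial_drift:
  assumes "\<kappa> \<noteq> 0"
    and drift: "\<forall>\<^sub>F s in at_right 0. \<kappa> * ((cmod (w s))\<^sup>2 - s\<^sup>2) > 0"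
    and bound: "\<forall>\<^sub>F s in at_right 0. s\<^sup>2 * \<bar>P (w s) - P (of_real s)\<bar> \<le> K * P (of_real s) * \<bar>(cmod (w s))\<^sup>2 - s\<^sup>2\<bar>"
    and lim: "((\<lambda>s. (cmod (w s) / s)\<^sup>2) \<longlongrightarrow> 1) (at_right 0)"
  shows False
proof -
  define K' where "K' = \<bar>K\<bar> + 1"
  have K': "K' > 0" "K \<le> K'" by (auto simp: K'_def)
  define x where "x = (\<lambda>s. (cmod (w s) / s)\<^sup>2)"
  have small: "\<forall>\<^sub>F s in at_right 0. 0 < s \<and> s < \<epsilon>"
    using eventually_at_right_real[OF eps] by eventually_elim auto
  have x_bound: "\<forall>\<^sub>F s in at_right 0. \<bar>P (w s) - P (of_real s)\<bar> \<le> P (of_real s) * (K' * \<bar>x s - 1\<bar>)"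
    using bound small
  proof eventually_elim
    case (elim s)
    have "(cmod (w s))\<^sup>2 - s\<^sup>2 = s\<^sup>2 * (x s - 1)" using elim by (simp add: x_def field_simps)
    then have "s\<^sup>2 * \<bar>P (w s) - P (of_real s)\<bar> \<le> s\<^sup>2 * (K * P (of_real s) * \<bar>x s - 1\<bar>)"
      using elim by (simp add: abs_mult mult_ac)
    then have "\<bar>P (w s) - P (of_real s)\<bar> \<le> K * P (of_real s) * \<bar>x s - 1\<bar>" using elim by simp
    also have "\<dots> \<le> K' * P (of_real s) * \<bar>x s - 1\<bar>"
      using K' P_pos[of "of_real s"] elim by (intro mult_right_mono) auto
    finally show ?case by (simp add: mult_ac)
  qed
  have sign: "\<forall>\<^sub>F s in at_right 0. \<kappa> * (x s - 1) > 0"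
    using drift small
  proof eventually_elim
    case (elim s)
    have "\<kappa> * ((cmod (w s))\<^sup>2 - s\<^sup>2) = s\<^sup>2 * (\<kappa> * (x s - 1))" using elim by (simp add: x_def field_simps)
    with elim have "0 < s\<^sup>2 * (\<kappa> * (x s - 1))" "0 < s\<^sup>2" by simp_all
    then show ?case by (rule zero_less_mult_pos)
  qed
  have lim': "(x \<longlongrightarrow> 1) (at_right 0)" using lim by (simp add: x_def)
  show False
  proof (cases "\<kappa> < 0")
    case True
    obtain N \<eta> where N: "\<eta> > 0" "\<And>x. 1 - \<eta> < x \<Longrightarrow> x \<le> 1 \<Longrightarrow> x ^ N \<le> 1 - K' * (1 - x)"
      using power_le_linear[OF K'(1)] by blast
    have "\<forall>\<^sub>F s in at_right 0. max 0 (1 - \<eta>) < x s" using lim' N(1) by (intro order_tendstoD) auto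
    then have "\<forall>\<^sub>F s in at_right 0. \<exists>w. 0 < cmod w \<and> cmod w < s \<and> P w \<ge> P (of_real s) * (cmod w / s) ^ (2 * N)"
      using x_bound sign small
    proof eventually_elim
      case (elim s)
      then have x1: "x s < 1" using True by (auto simp: zero_less_mult_iff)
      have "cmod (w s) / s < 1" using x1 elim unfolding x_def by (simp add: power2_less_1_iff abs_if split: if_splits)
      then have "cmod (w s) < s" using elim by simp
      moreover have "0 < cmod (w s)" using elim(1) by (auto simp: x_def)
      moreover have "P (of_real s) * x s ^ N \<le> P (w s)"
      proof -
        have "P (of_real s) * x s ^ N \<le> P (of_real s) * (1 - K' * (1 - x s))"
          using N(2)[of "x s"] x1 elim P_pos[of "of_real s"] by (intro mult_left_mono) auto
        also have "\<dots> \<le> P (w s)" using elim(2) x1 by (auto simp: algebra_simps abs_if split: if_splits)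
        finally show ?thesis .
      qed
      ultimately show ?case by (intro exI[of _ "w s"]) (simp add: x_def power_mult)
    qed
    then show False by (rule no_descent)
  next
    case False
    obtain N :: nat where N: "K' \<le> real N" using real_arch_simple by blast
    have "\<forall>\<^sub>F s in at_right 0. x s < 4" using lim' by (intro order_tendstoD) auto
    then have "\<forall>\<^sub>F s in at_right 0. \<exists>w. s < cmod w \<and> cmod w \<le> 2 * s \<and> P w \<le> P (of_real s) * (cmod w / s) ^ (2 * N)"
      using x_bound sign small
    proof eventually_elim
      case (elim s)
      then have x1: "x s > 1" using False \<open>\<kappa> \<noteq> 0\<close> by (auto simp: zero_less_mult_iff)
      have "(cmod (w s) / s)\<^sup>2 > 1\<^sup>2" using x1 by (simp add: x_def)
      then have "cmod (w s) / s > 1" by (rule power2_less_imp_less) (use elim in auto)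
      then have "s < cmod (w s)" using elim by simp
      moreover have "(cmod (w s) / s)\<^sup>2 < 2\<^sup>2" using elim(1) by (simp add: x_def)
      then have "cmod (w s) / s < 2" by (rule power2_less_imp_less) auto
      then have "cmod (w s) \<le> 2 * s" using elim by (simp add: field_simps)
      moreover have "P (w s) \<le> P (of_real s) * x s ^ N"
      proof -
        have "P (w s) \<le> P (of_real s) * (1 + K' * (x s - 1))"
          using elim(2) x1 by (auto simp: algebra_simps abs_if split: if_splits)
        also have "1 + K' * (x s - 1) \<le> 1 + real N * (x s - 1)"
          using N x1 by (intro add_left_mono mult_right_mono) auto
        also have "\<dots> \<le> (1 + (x s - 1)) ^ N" using x1 by (intro Bernoulli_inequality) auto
        finally show ?thesis using P_pos[of "of_real s"] elim by (simp add: mult_left_mono)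
      qed
      ultimately show ?case by (intro exI[of _ "w s"]) (simp add: x_def power_mult)
    qed
    then show False by (rule no_ascent)
  qed
qed

lemma eventually_along_ray:
  assumes "cmod \<omega> = 1" "\<forall>\<^sub>F z in at 0. R z"
  shows "\<forall>\<^sub>F s in at_right 0. R (of_real s * \<omega>)"
proof -
  have "\<omega> \<noteq> 0" using assms(1) by auto
  then have "filterlim (\<lambda>s. of_real s * \<omega>) (at 0) (at_right 0)"
    unfolding filterlim_at by (auto intro!: tendsto_eq_intros simp: eventually_at_right_field intro: exI[of _ 1])
  then show ?thesis using assms(2) unfolding filterlim_iff by blast
qed

lemma P_ray: "cmod \<omega> = 1 \<Longrightarrow> 0 < s \<Longrightarrow> s < \<epsilon> \<Longrightarrow> P (of_real s * \<omega>) = P (of_real s)"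
  using P_radial[of "of_real s * \<omega>"] by (simp add: norm_mult)

text \<open>On the ray in direction \<open>\<omega>\<close> the left-hand side is exactly \<open>P ^ n * s ^ m\<close> times a nonzero constant.\<close>

lemma leading_term_not_small:
  assumes "cmod \<omega> = 1" "Re (A * \<omega> ^ m) \<noteq> 0"
    and bigo: "(\<lambda>z. of_real (Re (p z ^ n * (A * z ^ m)))) \<in> O[at 0](\<lambda>z. p z ^ n * z ^ Suc m)"
  shows False
proof -
  let ?c = "\<bar>Re (A * \<omega> ^ m)\<bar>"
  obtain C where C: "C > 0" "\<forall>\<^sub>F z in at 0. cmod (of_real (Re (p z ^ n * (A * z ^ m)))) \<le> C * cmod (p z ^ n * z ^ Suc m)"
    using bigo by (rule landau_o.bigE)
  have "\<forall>\<^sub>F s in at_right 0. s \<in> {0<..<min \<epsilon> (?c / C)}"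
    using eps C assms by (intro eventually_at_right_real) auto
  then have "\<forall>\<^sub>F s::real in at_right 0. False"
    using eventually_along_ray[OF assms(1) C(2)]
  proof eventually_elim
    case (elim s)
    define z where "z = of_real s * \<omega>"
    have s: "0 < s" "s < \<epsilon>" "C * s < ?c" using elim(1) C(1) by (auto simp: field_simps)
    have "cmod z = s" using assms(1) s by (simp add: z_def norm_mult)
    then have "P z > 0" using s by (intro P_pos) auto
    have "p z ^ n * (A * z ^ m) = of_real (P z ^ n * s ^ m) * (A * \<omega> ^ m)"
      by (simp add: z_def power_mult_distrib)
    then have "Re (p z ^ n * (A * z ^ m)) = P z ^ n * s ^ m * Re (A * \<omega> ^ m)"
      by (simp only: Re_of_real_mult)
    then have "P z ^ n * s ^ m * ?c \<le> C * (P z ^ n * s ^ Suc m)"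
      using elim(2) \<open>P z > 0\<close> s \<open>cmod z = s\<close> unfolding z_def[symmetric] norm_of_real norm_mult norm_power
      by (simp add: abs_mult)
    also have "\<dots> = P z ^ n * s ^ m * (C * s)" by simp
    finally have "?c \<le> C * s" using \<open>P z > 0\<close> s by (simp add: mult_le_cancel_left)
    then show ?case using s by simp
  qed
  then show False by simp
qed

end

section \<open>Points of the hypersurface over which the first coordinate is comparable with the flat function\<close>

context infinite_type_hypersurface
begin

text \<open>The first coordinate of the point of \<open>M\<close> over \<open>z\<close> whose imaginary part is \<open>Im \<zeta> * P z\<close>. Its real
part is then forced, and \<open>Z \<zeta> z\<close> agrees with \<open>\<zeta> * P z\<close> to leading order if \<open>Re \<zeta> = -1\<close>.\<close>

definition Z :: "complex \<Rightarrow> complex \<Rightarrow> complex" where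
  "Z \<zeta> z = p z * (\<zeta> - of_real (Im \<zeta> * Q (z, Im \<zeta> * P z)))"

lemma Im_Z: "Im (Z \<zeta> z) = Im \<zeta> * P z"
  by (simp add: Z_def)

lemma Re_Z: "Re \<zeta> = -1 \<Longrightarrow> Re (Z \<zeta> z) + P z + Im (Z \<zeta> z) * Q (z, Im (Z \<zeta> z)) = 0"
  unfolding Im_Z by (simp add: Z_def algebra_simps)

lemma p_bigo_id: "p \<in> O[at 0](\<lambda>z. z)"
  using p_bigo[of 1] by simp

lemma p_power_bigo_1: "(\<lambda>z. p z ^ j) \<in> O[at 0](\<lambda>_. 1)"
  using landau_o.big_power[OF p_bigo[of 0], of j] by simp

lemma p_power_mult_bigo_id:
  assumes "n \<ge> 1 \<or> l \<ge> k"
  shows "(\<lambda>z. p z ^ n * z ^ l) \<in> O[at 0](\<lambda>z. z ^ k)"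
proof (cases "n \<ge> 1")
  case True
  then obtain n' where n: "n = Suc n'" by (cases n) auto
  have "(\<lambda>z. p z * p z ^ n' * z ^ l) \<in> O[at 0](\<lambda>z. z ^ k * 1 * 1)"
    using power_bigo_power_at_0[of 0 l] by (intro landau_o.big.mult p_bigo p_power_bigo_1) simp
  then show ?thesis by (simp add: n)
next
  case False
  have "(\<lambda>z. p z ^ n * z ^ l) \<in> O[at 0](\<lambda>z. 1 * z ^ k)"
    using assms False by (intro landau_o.big.mult p_power_bigo_1 power_bigo_power_at_0) auto
  then show ?thesis by simp
qed

lemma Q_test_bigo: "(\<lambda>z. complex_of_real (Q (z, Im \<zeta> * P z))) \<in> O[at 0](\<lambda>z. z)"
proof -
  have t: "(\<lambda>z. of_real (Im \<zeta>) * p z) \<in> O[at 0](\<lambda>z. z)"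
    by (cases "Im \<zeta> = 0") (simp_all add: p_bigo_id)
  then have "((\<lambda>z. of_real (Im \<zeta>) * p z) \<longlongrightarrow> 0) (at 0)" by (rule bigo_at_0_imp_tendsto_0)
  then have "((\<lambda>z. Re (of_real (Im \<zeta>) * p z)) \<longlongrightarrow> Re 0) (at 0)" by (rule tendsto_Re)
  then have t0: "((\<lambda>z. Im \<zeta> * P z) \<longlongrightarrow> 0) (at 0)" by simp
  have "(\<lambda>z. complex_of_real (Q (z, Im \<zeta> * P z) - Q (0, 0))) \<in> O[at 0](\<lambda>z. z)"
    by (rule Q_diff_bigo) (use t0 t in \<open>auto intro!: tendsto_eq_intros\<close>)
  then show ?thesis by (simp add: Q_0)
qed

lemma Z_approx: "(\<lambda>z. Z \<zeta> z - p z * \<zeta>) \<in> O[at 0](\<lambda>z. p z * z)"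
proof -
  have "(\<lambda>z. p z * (- of_real (Im \<zeta>) * of_real (Q (z, Im \<zeta> * P z)))) \<in> O[at 0](\<lambda>z. p z * z)"
    by (intro landau_o.big.mult landau_o.big_refl)
       (cases "Im \<zeta> = 0"; simp add: Q_test_bigo)
  then show ?thesis by (simp add: Z_def algebra_simps)
qed

lemma Z_bigo: "Z \<zeta> \<in> O[at 0](p)"
proof -
  have "(\<lambda>z. p z * z) \<in> O[at 0](\<lambda>z. p z * 1)"
    by (intro landau_o.big.mult landau_o.big_refl) (use power_bigo_power_at_0[of 0 1] in simp)
  then have "(\<lambda>z. (Z \<zeta> z - p z * \<zeta>) + p z * \<zeta>) \<in> O[at 0](p)"
    by (intro sum_in_bigo landau_o.big_trans[OF Z_approx]) auto
  then show ?thesis by simp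
qed

lemma Z_tendsto_0: "(Z \<zeta> \<longlongrightarrow> 0) (at 0)"
  by (rule bigo_at_0_imp_tendsto_0, rule landau_o.big_trans[OF Z_bigo p_bigo_id])

lemma eventually_test_points:
  assumes "\<forall>\<^sub>F v in nhds (0, 0). R v"
  shows "\<forall>\<^sub>F z in at 0. R (Z \<zeta> z, z)"
proof -
  have "((\<lambda>z. (Z \<zeta> z, z)) \<longlongrightarrow> (0, 0)) (at 0)"
    by (intro tendsto_Pair Z_tendsto_0) auto
  with assms show ?thesis unfolding filterlim_iff by blast
qed

lemma eventually_test_in_M:
  assumes "Re \<zeta> = -1"
  shows "\<forall>\<^sub>F z in at 0. (Z \<zeta> z, z) \<in> M"
proof -
  have "open {v::complex \<times> complex. cmod (snd v) < \<epsilon> \<and> \<bar>Im (fst v)\<bar> < \<delta>}"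
    by (intro open_Collect_conj open_Collect_less continuous_intros)
  then have "\<forall>\<^sub>F v in nhds (0, 0). v \<in> {v::complex \<times> complex. cmod (snd v) < \<epsilon> \<and> \<bar>Im (fst v)\<bar> < \<delta>}"
    using eps del by (intro eventually_nhds_in_open) auto
  from eventually_test_points[OF this, of \<zeta>] show ?thesis
    by eventually_elim (use Re_Z[OF assms] in \<open>auto simp: M_def abs_less_iff\<close>)
qed

lemma test_point_remainder:
  assumes "r > 0" and hol: "\<And>y. y \<in> cball 0 r \<Longrightarrow> (\<lambda>x. F x y) holomorphic_on cball 0 r"
    and bd: "\<And>x y. x \<in> cball 0 r \<Longrightarrow> y \<in> cball 0 r \<Longrightarrow> cmod (F x y) < K"
  shows "(\<lambda>z. F (Z \<zeta> z) z - (\<Sum>j<k. fst_coeff F j z * Z \<zeta> z ^ j)) \<in> O[at 0](\<lambda>z. p z ^ k)"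
proof -
  have "\<forall>\<^sub>F z in at 0. dist (Z \<zeta> z) 0 < r / 2"
    using Z_tendsto_0 \<open>r > 0\<close> by (intro tendstoD) auto
  then have "\<forall>\<^sub>F z in at 0. cmod (F (Z \<zeta> z) z - (\<Sum>j<k. fst_coeff F j z * Z \<zeta> z ^ j))
      \<le> 2 * K / r ^ k * cmod (Z \<zeta> z ^ k)"
    using eventually_small[OF \<open>r > 0\<close>]
    by eventually_elim (unfold norm_power, rule fst_coeff_remainder[OF \<open>r > 0\<close> hol bd], auto)
  then have "(\<lambda>z. F (Z \<zeta> z) z - (\<Sum>j<k. fst_coeff F j z * Z \<zeta> z ^ j)) \<in> O[at 0](\<lambda>z. Z \<zeta> z ^ k)"
    by (rule bigoI)
  also have "(\<lambda>z. Z \<zeta> z ^ k) \<in> O[at 0](\<lambda>z. p z ^ k)"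
    by (rule landau_o.big_power[OF Z_bigo])
  finally show ?thesis .
qed

text \<open>Three approximations are combined: the tail of the expansion is \<open>O(P ^ (k + 1))\<close>, hence negligible;
the \<open>k\<close>-th coefficient is replaced by its leading term; and \<open>Z\<close> is replaced by \<open>\<zeta> * P\<close>.\<close>

lemma test_point_expansion:
  assumes "r > 0" and hol: "\<And>y. y \<in> cball 0 r \<Longrightarrow> (\<lambda>x. F x y) holomorphic_on cball 0 r"
    and bd: "\<And>x y. x \<in> cball 0 r \<Longrightarrow> y \<in> cball 0 r \<Longrightarrow> cmod (F x y) < K"
    and zero: "\<And>j y. j < k \<Longrightarrow> y \<in> ball 0 r \<Longrightarrow> fst_coeff F j y = 0"
    and lead: "(\<lambda>y. fst_coeff F k y - c * y ^ m) \<in> O[at 0](\<lambda>y. y ^ Suc m)"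
  shows "(\<lambda>z. F (Z \<zeta> z) z - p z ^ k * (\<zeta> ^ k * c * z ^ m)) \<in> O[at 0](\<lambda>z. p z ^ k * z ^ Suc m)"
proof -
  let ?O = "O[at 0](\<lambda>z. p z ^ k * z ^ Suc m)"
  have "(\<lambda>z. F (Z \<zeta> z) z - (\<Sum>j<Suc k. fst_coeff F j z * Z \<zeta> z ^ j)) \<in> O[at 0](\<lambda>z. p z ^ Suc k)"
    by (rule test_point_remainder[OF \<open>r > 0\<close> hol bd])
  also have "(\<lambda>z. p z ^ Suc k) \<in> ?O"
    unfolding power_Suc2[of "p _"] by (intro landau_o.big.mult landau_o.big_refl p_bigo)
  finally have 1: "(\<lambda>z. F (Z \<zeta> z) z - (\<Sum>j<Suc k. fst_coeff F j z * Z \<zeta> z ^ j)) \<in> ?O" .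
  have ev: "\<forall>\<^sub>F z in at 0. (\<Sum>j<Suc k. fst_coeff F j z * Z \<zeta> z ^ j) = fst_coeff F k z * Z \<zeta> z ^ k"
    using eventually_small[OF \<open>r > 0\<close>] by eventually_elim (use zero in simp)
  have "(\<lambda>z. F (Z \<zeta> z) z - (\<Sum>j<Suc k. fst_coeff F j z * Z \<zeta> z ^ j)) \<in> ?O \<longleftrightarrow>
        (\<lambda>z. F (Z \<zeta> z) z - fst_coeff F k z * Z \<zeta> z ^ k) \<in> ?O"
    by (rule landau_o.big.in_cong, use ev in eventually_elim) simp
  with 1 have 2: "(\<lambda>z. F (Z \<zeta> z) z - fst_coeff F k z * Z \<zeta> z ^ k) \<in> ?O" by blast
  have 3: "(\<lambda>z. Z \<zeta> z ^ k * (fst_coeff F k z - c * z ^ m)) \<in> ?O"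
    by (intro landau_o.big.mult lead landau_o.big_power Z_bigo)
  have "(\<lambda>z. \<zeta> - of_real (Im \<zeta>) * complex_of_real (Q (z, Im \<zeta> * P z))) \<in> O[at 0](\<lambda>_. 1)" (is "?X \<in> _")
  proof (intro sum_in_bigo)
    have "(\<lambda>z. complex_of_real (Q (z, Im \<zeta> * P z))) \<in> O[at 0](\<lambda>_. 1)"
      using landau_o.big_trans[OF Q_test_bigo[of \<zeta>] power_bigo_power_at_0[of 0 1, simplified]] .
    then show "(\<lambda>z. of_real (Im \<zeta>) * complex_of_real (Q (z, Im \<zeta> * P z))) \<in> O[at 0](\<lambda>_. 1)"
      by (cases "Im \<zeta> = 0") auto
  qed auto
  then have "(\<lambda>z. ?X z ^ k - \<zeta> ^ k) \<in> O[at 0](\<lambda>z. z)"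
    by (rule bigo_power_diff) (use Q_test_bigo[of \<zeta>] in \<open>cases "Im \<zeta> = 0"; auto\<close>)+
  then have "(\<lambda>z. p z ^ k * z ^ m * ((?X z ^ k - \<zeta> ^ k) * c)) \<in> O[at 0](\<lambda>z. p z ^ k * z ^ m * z)"
    by (intro landau_o.big.mult landau_o.big_refl) (cases "c = 0"; simp)
  then have 4: "(\<lambda>z. c * z ^ m * Z \<zeta> z ^ k - p z ^ k * (\<zeta> ^ k * c * z ^ m)) \<in> ?O"
  proof -
    have "c * z ^ m * Z \<zeta> z ^ k - p z ^ k * (\<zeta> ^ k * c * z ^ m) = p z ^ k * z ^ m * ((?X z ^ k - \<zeta> ^ k) * c)" for z
    proof -
      have "Z \<zeta> z ^ k = p z ^ k * ?X z ^ k"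
        unfolding Z_def power_mult_distrib by (simp only: of_real_mult)
      then show ?thesis by (simp only: right_diff_distrib left_diff_distrib mult_ac)
    qed
    with \<open>(\<lambda>z. p z ^ k * z ^ m * ((?X z ^ k - \<zeta> ^ k) * c)) \<in> O[at 0](\<lambda>z. p z ^ k * z ^ m * z)\<close>
    show ?thesis by (simp only: power_Suc2 mult.assoc)
  qed
  have "(\<lambda>z. (F (Z \<zeta> z) z - fst_coeff F k z * Z \<zeta> z ^ k) + (Z \<zeta> z ^ k * (fst_coeff F k z - c * z ^ m))
          + (c * z ^ m * Z \<zeta> z ^ k - p z ^ k * (\<zeta> ^ k * c * z ^ m))) \<in> ?O"
    by (intro sum_in_bigo 2 3 4)
  then show ?thesis by (simp add: algebra_simps)
qed

end

section \<open>Displacement maps that preserve the hypersurface\<close>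

text \<open>A map that preserves the germ of \<open>M\<close>, written as the identity plus a displacement \<open>(g1, g2)\<close>. Expansions
of the displacement start directly with the terms of interest.\<close>

locale hypersurface_map = infinite_type_hypersurface +
  fixes g1 g2 :: "complex \<Rightarrow> complex \<Rightarrow> complex" and r K :: real
  assumes r_pos: "r > 0"
    and hol1_fst: "\<And>y. y \<in> cball 0 r \<Longrightarrow> (\<lambda>x. g1 x y) holomorphic_on cball 0 r"
    and hol1_snd: "\<And>x. x \<in> cball 0 r \<Longrightarrow> (\<lambda>y. g1 x y) holomorphic_on cball 0 r"
    and hol2_fst: "\<And>y. y \<in> cball 0 r \<Longrightarrow> (\<lambda>x. g2 x y) holomorphic_on cball 0 r"
    and hol2_snd: "\<And>x. x \<in> cball 0 r \<Longrightarrow> (\<lambda>y. g2 x y) holomorphic_on cball 0 r"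
    and bd1: "\<And>x y. x \<in> cball 0 r \<Longrightarrow> y \<in> cball 0 r \<Longrightarrow> cmod (g1 x y) < K"
    and bd2: "\<And>x y. x \<in> cball 0 r \<Longrightarrow> y \<in> cball 0 r \<Longrightarrow> cmod (g2 x y) < K"
    and cont2: "continuous_on (cball 0 r \<times> cball 0 r) (\<lambda>(x, y). g2 x y)"
    and g1_0: "g1 0 0 = 0" and g2_0: "g2 0 0 = 0"
    and preserves: "\<forall>\<^sub>F v in nhds (0, 0). v \<in> M \<longrightarrow> (fst v + g1 (fst v) (snd v), snd v + g2 (fst v) (snd v)) \<in> M"
begin

text \<open>The two components of the displacement at the test point over \<open>z\<close>, and the second coordinate of the
image of this point.\<close>

abbreviation D1 where "D1 \<zeta> z \<equiv> g1 (Z \<zeta> z) z"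
abbreviation D2 where "D2 \<zeta> z \<equiv> g2 (Z \<zeta> z) z"
abbreviation W where "W \<zeta> z \<equiv> z + D2 \<zeta> z"

lemma eventually_image_in_M:
  assumes "Re \<zeta> = -1"
  shows "\<forall>\<^sub>F z in at 0. (Z \<zeta> z + D1 \<zeta> z, W \<zeta> z) \<in> M"
  using eventually_test_points[OF preserves, of \<zeta>] eventually_test_in_M[OF assms]
  by eventually_elim simp

lemma remainder1:
  "(\<lambda>z. D1 \<zeta> z - (\<Sum>j<k. fst_coeff g1 j z * Z \<zeta> z ^ j)) \<in> O[at 0](\<lambda>z. p z ^ k)"
  using test_point_remainder[where F = g1, OF r_pos] hol1_fst bd1 by blast

lemma expansion1:
  assumes "\<And>j y. j < k \<Longrightarrow> y \<in> ball 0 r \<Longrightarrow> fst_coeff g1 j y = 0"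
    and "(\<lambda>y. fst_coeff g1 k y - c * y ^ m) \<in> O[at 0](\<lambda>y. y ^ Suc m)"
  shows "(\<lambda>z. D1 \<zeta> z - p z ^ k * (\<zeta> ^ k * c * z ^ m)) \<in> O[at 0](\<lambda>z. p z ^ k * z ^ Suc m)"
  by (rule test_point_expansion[where F = g1, OF r_pos hol1_fst bd1 assms])

lemma remainder2:
  "(\<lambda>z. D2 \<zeta> z - (\<Sum>j<k. fst_coeff g2 j z * Z \<zeta> z ^ j)) \<in> O[at 0](\<lambda>z. p z ^ k)"
  using test_point_remainder[where F = g2, OF r_pos] hol2_fst bd2 by blast

lemma expansion2:
  assumes "\<And>j y. j < k \<Longrightarrow> y \<in> ball 0 r \<Longrightarrow> fst_coeff g2 j y = 0"
    and "(\<lambda>y. fst_coeff g2 k y - c * y ^ m) \<in> O[at 0](\<lambda>y. y ^ Suc m)"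
  shows "(\<lambda>z. D2 \<zeta> z - p z ^ k * (\<zeta> ^ k * c * z ^ m)) \<in> O[at 0](\<lambda>z. p z ^ k * z ^ Suc m)"
  by (rule test_point_expansion[where F = g2, OF r_pos hol2_fst bd2 assms])

text \<open>Subtract the equation of \<open>M\<close> at the test point from its equation at the image point. The difference of
the \<open>Q\<close>-terms splits into \<open>Im D1 * Q\<close>, where \<open>Q = O(z)\<close> because \<open>Q (0, 0) = 0\<close>, and \<open>Im Z\<close> times an
increment of \<open>Q\<close>, where \<open>Im Z = O(P)\<close> and \<open>Q\<close> is Lipschitz. Both are as small as \<open>E\<close>, so that only
\<open>Re L\<close> remains to balance the increment of \<open>P\<close>.\<close>

lemma defect_estimate:
  assumes \<zeta>: "Re \<zeta> = -1"
    and d1: "(\<lambda>z. D1 \<zeta> z - L z) \<in> O[at 0](E)" and Lz: "(\<lambda>z. L z * z) \<in> O[at 0](E)"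
    and d1z: "D1 \<zeta> \<in> O[at 0](\<lambda>z. z)" and d2z: "D2 \<zeta> \<in> O[at 0](\<lambda>z. z)"
    and pd2: "(\<lambda>z. p z * D2 \<zeta> z) \<in> O[at 0](E)"
  shows "(\<lambda>z. p (W \<zeta> z) - p z + of_real (Re (L z))) \<in> O[at 0](E)"
proof -
  let ?O = "O[at 0](E)"
  have W_bigo: "W \<zeta> \<in> O[at 0](\<lambda>z. z)" using d2z by (intro sum_in_bigo) auto
  have id1: "(\<lambda>z::complex. z) \<in> O[at 0](\<lambda>_. 1)" using power_bigo_power_at_0[of 0 1] by simp
  have D1z: "(\<lambda>z. D1 \<zeta> z * z) \<in> ?O"
  proof -
    have "(\<lambda>z. (D1 \<zeta> z - L z) * z) \<in> O[at 0](\<lambda>z. E z * 1)"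
      by (intro landau_o.big.mult d1 id1)
    then have "(\<lambda>z. (D1 \<zeta> z - L z) * z + L z * z) \<in> ?O" by (intro sum_in_bigo Lz) simp
    then show ?thesis by (simp add: algebra_simps)
  qed
  have Zz: "Z \<zeta> \<in> O[at 0](\<lambda>z. z)" by (rule landau_o.big_trans[OF Z_bigo p_bigo_id])
  define t where "t = (\<lambda>z. Im (Z \<zeta> z + D1 \<zeta> z))"
  define u where "u = (\<lambda>z. Im (Z \<zeta> z))"
  have t_bigo: "(\<lambda>z. complex_of_real (t z)) \<in> O[at 0](\<lambda>z. z)" unfolding t_def
    by (intro bigo_Im sum_in_bigo Zz d1z)
  have u_bigo: "(\<lambda>z. complex_of_real (u z)) \<in> O[at 0](\<lambda>z. z)" unfolding u_def
    by (intro bigo_Im Zz)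
  have lim: "(W \<zeta> \<longlongrightarrow> 0) (at 0)" "(t \<longlongrightarrow> 0) (at 0)" "(u \<longlongrightarrow> 0) (at 0)"
    using bigo_at_0_imp_tendsto_0[OF W_bigo] tendsto_Re[OF bigo_at_0_imp_tendsto_0[OF t_bigo]]
      tendsto_Re[OF bigo_at_0_imp_tendsto_0[OF u_bigo]] by auto
  have QW: "(\<lambda>z. complex_of_real (Q (W \<zeta> z, t z) - Q (0, 0))) \<in> O[at 0](\<lambda>z. z)"
    by (rule Q_diff_bigo) (use lim W_bigo t_bigo in auto)
  define h where "h = (\<lambda>z. cmod (D2 \<zeta> z) + cmod (D1 \<zeta> z))"
  have QD: "(\<lambda>z. complex_of_real (Q (W \<zeta> z, t z) - Q (z, u z))) \<in> O[at 0](\<lambda>z. of_real (h z))"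
  proof (rule Q_diff_bigo)
    show "(\<lambda>z. W \<zeta> z - z) \<in> O[at 0](\<lambda>z. of_real (h z))"
      by (rule bigoI[where c = 1]) (simp add: h_def flip: of_real_add)
    have "D1 \<zeta> \<in> O[at 0](\<lambda>z. of_real (h z))"
      by (rule bigoI[where c = 1]) (simp add: h_def flip: of_real_add)
    from bigo_Im[OF this] show "(\<lambda>z. of_real (t z - u z)) \<in> O[at 0](\<lambda>z. complex_of_real (h z))"
      by (simp add: t_def u_def)
  qed (use lim in auto)
  have ph: "(\<lambda>z. p z * of_real (h z)) \<in> ?O"
  proof -
    have "(\<lambda>z. p z * D1 \<zeta> z) \<in> O[at 0](\<lambda>z. z * D1 \<zeta> z)"
      by (intro landau_o.big.mult landau_o.big_refl p_bigo_id)
    then have "(\<lambda>z. p z * D1 \<zeta> z) \<in> ?O" using landau_o.big_trans[OF _ D1z] by (simp add: mult.commute)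
    with pd2 have "(\<lambda>z. cmod (p z * D2 \<zeta> z) + cmod (p z * D1 \<zeta> z)) \<in> O[at 0](\<lambda>z. cmod (E z))"
      by (intro sum_in_bigo; subst landau_o.big.norm_iff)
    also have "(\<lambda>z. cmod (p z * D2 \<zeta> z) + cmod (p z * D1 \<zeta> z)) = (\<lambda>z. cmod (p z * of_real (h z)))"
      by (auto simp: h_def norm_mult algebra_simps simp flip: of_real_add)
    finally show ?thesis by (simp only: landau_o.big.norm_iff)
  qed
  have T1: "(\<lambda>z. of_real (Re (D1 \<zeta> z - L z))) \<in> ?O" by (rule bigo_Re[OF d1])
  have T2: "(\<lambda>z. of_real (Im (D1 \<zeta> z)) * complex_of_real (Q (W \<zeta> z, t z))) \<in> ?O"
  proof -
    have "(\<lambda>z. of_real (Im (D1 \<zeta> z)) * complex_of_real (Q (W \<zeta> z, t z))) \<in> O[at 0](\<lambda>z. D1 \<zeta> z * z)"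
      using QW by (intro landau_o.big.mult bigo_Im landau_o.big_refl) (simp add: Q_0)
    then show ?thesis by (rule landau_o.big_trans[OF _ D1z])
  qed
  have T3: "(\<lambda>z. of_real (u z) * complex_of_real (Q (W \<zeta> z, t z) - Q (z, u z))) \<in> ?O"
    by (rule landau_o.big_trans[OF landau_o.big.mult[OF _ QD] ph], unfold u_def, rule bigo_Im[OF Z_bigo])
  have "\<forall>\<^sub>F z in at 0. p (W \<zeta> z) - p z + of_real (Re (L z)) =
      - (of_real (Re (D1 \<zeta> z - L z)) + of_real (Im (D1 \<zeta> z)) * of_real (Q (W \<zeta> z, t z))
        + of_real (u z) * of_real (Q (W \<zeta> z, t z) - Q (z, u z)))"
    using eventually_image_in_M[OF \<zeta>]
  proof eventually_elim
    case (elim z)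
    then have "Re (Z \<zeta> z + D1 \<zeta> z) + P (W \<zeta> z) + t z * Q (W \<zeta> z, t z) = 0"
      by (simp add: M_def t_def)
    moreover have "Re (Z \<zeta> z) + P z + u z * Q (z, u z) = 0"
      using Re_Z[OF \<zeta>] by (simp add: u_def)
    moreover have "t z = u z + Im (D1 \<zeta> z)" by (simp add: t_def u_def)
    ultimately have "P (W \<zeta> z) - P z + Re (L z) =
      - (Re (D1 \<zeta> z - L z) + Im (D1 \<zeta> z) * Q (W \<zeta> z, t z) + u z * (Q (W \<zeta> z, t z) - Q (z, u z)))"
      by (simp add: algebra_simps)
    from arg_cong[OF this, of complex_of_real] show ?case
      by (simp only: of_real_add of_real_diff of_real_minus of_real_mult)
  qed
  then have "(\<lambda>z. p (W \<zeta> z) - p z + of_real (Re (L z))) \<in> ?O \<longleftrightarrow>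
     (\<lambda>z. - (of_real (Re (D1 \<zeta> z - L z)) + of_real (Im (D1 \<zeta> z)) * of_real (Q (W \<zeta> z, t z))
        + of_real (u z) * of_real (Q (W \<zeta> z, t z) - Q (z, u z)))) \<in> ?O"
    by (rule landau_o.big.in_cong)
  moreover have "(\<lambda>z. - (of_real (Re (D1 \<zeta> z - L z)) + of_real (Im (D1 \<zeta> z)) * of_real (Q (W \<zeta> z, t z))
        + of_real (u z) * complex_of_real (Q (W \<zeta> z, t z) - Q (z, u z)))) \<in> ?O"
    by (subst landau_o.big.uminus_in_iff, intro sum_in_bigo(1) T1 T2 T3)
  ultimately show ?thesis by blast
qed

text \<open>The defect estimate for displacements with explicit leading terms. The exponent \<open>k\<close> of the error is
limited by the error \<open>z ^ Suc m\<close> in the first component and by the contribution of the second component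
through \<open>Q\<close>, of order \<open>z ^ l\<close>.\<close>

lemma defect_estimate_power:
  assumes \<zeta>: "Re \<zeta> = -1"
    and d1: "(\<lambda>z. D1 \<zeta> z - p z ^ Suc n * (A * z ^ m)) \<in> O[at 0](\<lambda>z. p z ^ Suc n * z ^ Suc m)"
    and d2: "D2 \<zeta> \<in> O[at 0](\<lambda>z. p z ^ n * z ^ l)" and nl: "n \<ge> 1 \<or> l \<ge> 1"
    and k: "k \<le> Suc m" "k \<le> l"
  shows "(\<lambda>z. p (W \<zeta> z) - p z + of_real (Re (p z ^ Suc n * (A * z ^ m)))) \<in> O[at 0](\<lambda>z. p z ^ Suc n * z ^ k)"
proof (rule defect_estimate[OF \<zeta>])
  have E: "(\<lambda>z. p z ^ Suc n * z ^ j) \<in> O[at 0](\<lambda>z. p z ^ Suc n * z ^ k)" if "k \<le> j" for j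
    using that by (intro landau_o.big.mult landau_o.big_refl power_bigo_power_at_0)
  have L: "(\<lambda>z. p z ^ Suc n * (A * z ^ m)) \<in> O[at 0](\<lambda>z. p z ^ Suc n * z ^ m)"
    by (intro landau_o.big.mult landau_o.big_refl) (cases "A = 0"; simp)
  show "(\<lambda>z. D1 \<zeta> z - p z ^ Suc n * (A * z ^ m)) \<in> O[at 0](\<lambda>z. p z ^ Suc n * z ^ k)"
    by (rule landau_o.big_trans[OF d1 E[OF k(1)]])
  have "(\<lambda>z. p z ^ Suc n * (A * z ^ m) * z) \<in> O[at 0](\<lambda>z. p z ^ Suc n * z ^ m * z)"
    by (intro landau_o.big.mult[OF L] landau_o.big_refl)
  also have "(\<lambda>z. p z ^ Suc n * z ^ m * z) = (\<lambda>z. p z ^ Suc n * z ^ Suc m)" by (simp add: mult_ac)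
  also note E[OF k(1)]
  finally show "(\<lambda>z. p z ^ Suc n * (A * z ^ m) * z) \<in> O[at 0](\<lambda>z. p z ^ Suc n * z ^ k)" .
  have id: "(\<lambda>z. p z ^ Suc n * z ^ j) \<in> O[at 0](\<lambda>z. z)" for j
    using p_power_mult_bigo_id[of "Suc n" 1 j] by simp
  from sum_in_bigo(1)[OF landau_o.big_trans[OF d1 id] landau_o.big_trans[OF L id]]
  show "D1 \<zeta> \<in> O[at 0](\<lambda>z. z)" by simp
  show "D2 \<zeta> \<in> O[at 0](\<lambda>z. z)"
    using landau_o.big_trans[OF d2 p_power_mult_bigo_id[of n 1 l]] nl by simp
  have "(\<lambda>z. p z * D2 \<zeta> z) \<in> O[at 0](\<lambda>z. p z * (p z ^ n * z ^ l))"
    by (intro landau_o.big.mult d2 landau_o.big_refl)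
  also have "(\<lambda>z. p z * (p z ^ n * z ^ l)) = (\<lambda>z. p z ^ Suc n * z ^ l)" by (simp add: mult_ac)
  also note E[OF k(2)]
  finally show "(\<lambda>z. p z * D2 \<zeta> z) \<in> O[at 0](\<lambda>z. p z ^ Suc n * z ^ k)" .
qed

end

section \<open>Directions in which real parts behave as prescribed\<close>

text \<open>The values at \<open>\<omega> = 1\<close> and at a \<open>k\<close>-th root of \<open>\<i>\<close> cannot both be purely imaginary.\<close>

lemma exists_unit_direction:
  assumes "C \<noteq> 0" "k \<ge> 1"
  shows "\<exists>\<omega>. cmod \<omega> = 1 \<and> Re (C * \<omega> ^ k) \<noteq> 0"
proof (cases "Re C = 0")
  case True
  have "real k * (pi / (2 * real k)) = pi / 2" using assms by (simp add: field_simps)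
  then have "cis (pi / (2 * real k)) ^ k = cis (pi / 2)" unfolding Complex.DeMoivre by (rule arg_cong)
  then have "cis (pi / (2 * real k)) ^ k = \<i>" by simp
  moreover have "Im C \<noteq> 0" using True assms by (simp add: complex_eq_iff)
  ultimately show ?thesis using True
    by (intro exI[of _ "cis (pi / (2 * real k))"]) simp
qed (auto intro!: exI[of _ 1])

text \<open>As \<open>\<zeta>\<close> runs through the line \<open>Re \<zeta> = -1\<close>, the argument of \<open>\<zeta> ^ n\<close> varies; if \<open>\<zeta> = -1\<close> gives a purely
imaginary value, then turning \<open>\<zeta>\<close> by \<open>pi / (4 * n)\<close> turns \<open>\<zeta> ^ n\<close> by an eighth of a full turn.\<close>

lemma exists_abscissa:
  assumes "C \<noteq> 0" "n \<ge> 1"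
  shows "\<exists>\<zeta>. Re \<zeta> = -1 \<and> Re (\<zeta> ^ n * C) \<noteq> 0"
proof (cases "Re C = 0")
  case True
  define \<phi> where "\<phi> = pi / (4 * real n)"
  define \<zeta> where "\<zeta> = of_real (- 1 / cos \<phi>) * cis \<phi>"
  have "pi * 1 < pi * (2 * real n)" using assms by (intro mult_strict_left_mono) auto
  then have "\<phi> < pi / 2" "\<phi> > 0" using assms by (auto simp: \<phi>_def field_simps)
  then have cos: "cos \<phi> > 0" by (intro cos_gt_zero) auto
  then have "Re \<zeta> = -1" by (simp add: \<zeta>_def)
  moreover have "\<zeta> ^ n = of_real ((- 1 / cos \<phi>) ^ n) * cis (pi / 4)"
  proof -
    have "real n * \<phi> = pi / 4" using assms by (simp add: \<phi>_def field_simps)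
    then show ?thesis 
      unfolding \<zeta>_def power_mult_distrib Complex.DeMoivre of_real_power by (simp only:)
  qed
  then have "Re (\<zeta> ^ n * C) = (- 1 / cos \<phi>) ^ n * Re (cis (pi / 4) * C)"
    by (simp only: Re_of_real_mult mult.assoc)
  moreover have "Re (cis (pi / 4) * C) \<noteq> 0"
  proof -
    have "Im C \<noteq> 0" using True assms by (simp add: complex_eq_iff)
    moreover have "sin (pi / 4) \<noteq> (0::real)" by (simp add: sin_45)
    ultimately show ?thesis using True by simp
  qed
  moreover have "(- 1 / cos \<phi>) ^ n \<noteq> 0" using cos by simp
  ultimately show ?thesis by (intro exI[of _ \<zeta>]) (simp only: mult_eq_0_iff de_Morgan_disj not_False_eq_True simp_thms)
next
  case False
  have "Re ((-1) ^ n * C) \<noteq> 0" using False by (cases "even n") auto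
  then show ?thesis by (intro exI[of _ "-1"]) auto
qed

text \<open>In two directions that differ by \<open>pi / j\<close> the real part of \<open>B * z ^ j\<close> vanishes and changes sign. If
\<open>0 < m < j\<close>, the value of \<open>A * z ^ m\<close> is turned by \<open>m * pi / j\<close> between these directions, an angle strictly
between \<open>0\<close> and \<open>pi\<close>, so it cannot be purely imaginary in both.\<close>

lemma exists_sign_change_direction:
  fixes A B :: complex
  assumes "A \<noteq> 0" "B \<noteq> 0" "m < j" and m0: "m = 0 \<Longrightarrow> Re A \<noteq> 0"
  shows "\<exists>\<theta> \<sigma>. (\<sigma> = 1 \<or> \<sigma> = -1) \<and> (\<forall>x. Re (B * cis (real j * (\<theta> + x))) = \<sigma> * (cmod B * sin (real j * x)))
           \<and> Re (A * cis (real m * \<theta>)) \<noteq> 0"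
proof -
  define \<theta> where "\<theta> = (pi / 2 - Arg B) / real j"
  have j: "real j > 0" using assms by simp
  have B: "B = of_real (cmod B) * cis (Arg B)"
    using assms by (simp add: cis_Arg sgn_eq)
  have R: "Re (B * cis (real j * (\<theta> + x))) = - (cmod B * sin (real j * x))" for x
  proof -
    have "Arg B + real j * (\<theta> + x) = pi / 2 + real j * x" using j by (simp add: \<theta>_def field_simps)
    then have "B * cis (real j * (\<theta> + x)) = of_real (cmod B) * cis (pi / 2 + real j * x)"
      by (subst B) (simp add: cis_mult mult.assoc)
    then show ?thesis by (simp add: cos_add)
  qed
  show ?thesis
  proof (cases "Re (A * cis (real m * \<theta>)) = 0")
    case False
    then show ?thesis using R by (intro exI[of _ \<theta>] exI[of _ "-1"]) simp
  next
    case True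
    have "m > 0" using True m0 by (cases m) auto
    define \<theta>' where "\<theta>' = \<theta> + pi / real j"
    have "Re (B * cis (real j * (\<theta>' + x))) = cmod B * sin (real j * x)" for x
    proof -
      have "real j * (pi / real j + x) = real j * x + pi" using j by (simp add: field_simps)
      then show ?thesis using R[of "pi / real j + x"] by (simp add: \<theta>'_def add.assoc)
    qed
    moreover have "Re (A * cis (real m * \<theta>')) \<noteq> 0"
    proof -
      define y where "y = A * cis (real m * \<theta>)"
      have "y \<noteq> 0" "Re y = 0" using True assms by (auto simp: y_def)
      then have "Im y \<noteq> 0" by (simp add: complex_eq_iff)
      have "A * cis (real m * \<theta>') = y * cis (real m * pi / real j)"
        by (simp add: y_def \<theta>'_def mult.assoc cis_mult algebra_simps)
      moreover have "sin (real m * pi / real j) > 0"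
        using \<open>m > 0\<close> \<open>m < j\<close> j by (intro sin_gt_zero) (auto simp: field_simps)
      ultimately show ?thesis using \<open>Re y = 0\<close> \<open>Im y \<noteq> 0\<close> by simp
    qed
    ultimately show ?thesis by (intro exI[of _ \<theta>'] exI[of _ 1]) simp
  qed
qed

section \<open>Leading terms of a displacement\<close>

context hypersurface_map
begin

lemma D2_bigo:
  assumes "(\<lambda>z. D2 \<zeta> z - p z ^ n * (B * z ^ l)) \<in> O[at 0](\<lambda>z. p z ^ n * z ^ Suc l)"
  shows "D2 \<zeta> \<in> O[at 0](\<lambda>z. p z ^ n * z ^ l)"
proof -
  have "(\<lambda>z. p z ^ n * z ^ Suc l) \<in> O[at 0](\<lambda>z. p z ^ n * z ^ l)"
    by (intro landau_o.big.mult landau_o.big_refl power_bigo_power_at_0) auto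
  moreover have "(\<lambda>z. p z ^ n * (B * z ^ l)) \<in> O[at 0](\<lambda>z. p z ^ n * z ^ l)"
    by (intro landau_o.big.mult landau_o.big_refl) (cases "B = 0"; simp)
  ultimately have "(\<lambda>z. (D2 \<zeta> z - p z ^ n * (B * z ^ l)) + p z ^ n * (B * z ^ l)) \<in> O[at 0](\<lambda>z. p z ^ n * z ^ l)"
    by (intro sum_in_bigo landau_o.big_trans[OF assms])
  then show ?thesis by simp
qed

text \<open>Expand \<open>(cmod (z + D2))\<^sup>2\<close>. The condition on \<open>n\<close> and \<open>l\<close> ensures \<open>D2 = O(z ^ 2)\<close>, which makes the
quadratic term \<open>(cmod D2)\<^sup>2\<close> negligible.\<close>

lemma norm_sq_expansion:
  assumes d2: "(\<lambda>z. D2 \<zeta> z - p z ^ n * (B * z ^ l)) \<in> O[at 0](\<lambda>z. p z ^ n * z ^ Suc l)"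
    and nl: "n \<ge> 1 \<or> l \<ge> 2"
  shows "(\<lambda>z. of_real ((cmod (W \<zeta> z))\<^sup>2 - (cmod z)\<^sup>2 - 2 * Re (cnj z * (p z ^ n * (B * z ^ l)))))
           \<in> O[at 0](\<lambda>z. p z ^ n * z ^ (l + 2))"
proof -
  let ?O = "O[at 0](\<lambda>z. p z ^ n * z ^ (l + 2))"
  let ?L = "\<lambda>z. p z ^ n * (B * z ^ l)"
  have "(\<lambda>z. cnj z * (D2 \<zeta> z - ?L z)) \<in> O[at 0](\<lambda>z. z * (p z ^ n * z ^ Suc l))"
    by (intro landau_o.big.mult d2) (auto intro: bigoI[where c = 1])
  also have "(\<lambda>z. z * (p z ^ n * z ^ Suc l)) = (\<lambda>z. p z ^ n * z ^ (l + 2))" by (simp add: mult_ac)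
  finally have "(\<lambda>z. 2 * of_real (Re (cnj z * (D2 \<zeta> z - ?L z)))) \<in> ?O"
    by (subst landau_o.big.cmult_in_iff) (auto dest: bigo_Re)
  moreover have "(\<lambda>z. D2 \<zeta> z * cnj (D2 \<zeta> z)) \<in> O[at 0](\<lambda>z. (p z ^ n * z ^ l) * z ^ 2)"
  proof (intro landau_o.big.mult D2_bigo[OF d2])
    have "(\<lambda>z. cnj (D2 \<zeta> z)) \<in> O[at 0](D2 \<zeta>)" by (auto intro: bigoI[where c = 1])
    also note D2_bigo[OF d2]
    also note p_power_mult_bigo_id[OF nl]
    finally show "(\<lambda>z. cnj (D2 \<zeta> z)) \<in> O[at 0](\<lambda>z. z ^ 2)" .
  qed
  then have "(\<lambda>z. D2 \<zeta> z * cnj (D2 \<zeta> z)) \<in> ?O" by (simp only: power_add mult.assoc)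
  ultimately have "(\<lambda>z. 2 * of_real (Re (cnj z * (D2 \<zeta> z - ?L z))) + D2 \<zeta> z * cnj (D2 \<zeta> z)) \<in> ?O"
    by (rule sum_in_bigo)
  moreover have "2 * of_real (Re (cnj z * (D2 \<zeta> z - ?L z))) + D2 \<zeta> z * cnj (D2 \<zeta> z) =
      of_real ((cmod (W \<zeta> z))\<^sup>2 - (cmod z)\<^sup>2 - 2 * Re (cnj z * ?L z))" for z
  proof -
    have gen: "(cmod (u + v))\<^sup>2 - (cmod u)\<^sup>2 - 2 * Re (cnj u * w) = 2 * Re (cnj u * (v - w)) + (cmod v)\<^sup>2" for u v w
      unfolding cmod_power2 by (simp add: power2_eq_square algebra_simps)
    show ?thesis unfolding gen by (simp only: of_real_add of_real_mult of_real_numeral complex_norm_square)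
  qed
  ultimately show ?thesis by simp
qed

text \<open>In direction \<open>\<omega>\<close> the squared modulus moves by about \<open>2 * P ^ n * s ^ (l + 1) * \<kappa>\<close> with \<open>\<kappa> \<noteq> 0\<close>, that is, by a
relative amount \<open>P ^ n * s ^ (l - 1)\<close>. As \<open>l \<le> m + 1\<close>, the relative change of \<open>P\<close> is of the same order
at most, and there is a radial drift.\<close>

lemma second_component_not_dominant:
  assumes \<zeta>: "Re \<zeta> = -1" and \<omega>: "cmod \<omega> = 1" "Re (cnj \<omega> * (B * \<omega> ^ l)) \<noteq> 0"
    and d1: "(\<lambda>z. D1 \<zeta> z - p z ^ Suc n * (A * z ^ m)) \<in> O[at 0](\<lambda>z. p z ^ Suc n * z ^ Suc m)"
    and d2: "(\<lambda>z. D2 \<zeta> z - p z ^ n * (B * z ^ l)) \<in> O[at 0](\<lambda>z. p z ^ n * z ^ Suc l)"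
    and nl: "n \<ge> 1 \<or> l \<ge> 2" and lm: "l \<le> Suc m"
  shows False
proof -
  define \<kappa> where "\<kappa> = Re (cnj \<omega> * (B * \<omega> ^ l))"
  have "\<kappa> \<noteq> 0" using \<omega> by (simp add: \<kappa>_def)
  have "(\<lambda>z. p (W \<zeta> z) - p z + of_real (Re (p z ^ Suc n * (A * z ^ m)))) \<in> O[at 0](\<lambda>z. p z ^ Suc n * z ^ (l - 1))"
    by (rule defect_estimate_power[OF \<zeta> d1 D2_bigo[OF d2]]) (use nl lm in auto)
  moreover have "(\<lambda>z. of_real (Re (p z ^ Suc n * (A * z ^ m)))) \<in> O[at 0](\<lambda>z. p z ^ Suc n * z ^ (l - 1))"
  proof (rule bigo_Re, intro landau_o.big.mult landau_o.big_refl)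
    have "(\<lambda>z. A * z ^ m) \<in> O[at 0](\<lambda>z. z ^ m)" by (cases "A = 0") auto
    also have "(\<lambda>z. z ^ m) \<in> O[at 0](\<lambda>z::complex. z ^ (l - 1))"
      using lm by (intro power_bigo_power_at_0) auto
    finally show "(\<lambda>z. A * z ^ m) \<in> O[at 0](\<lambda>z. z ^ (l - 1))" .
  qed
  ultimately have "(\<lambda>z. (p (W \<zeta> z) - p z + of_real (Re (p z ^ Suc n * (A * z ^ m))))
      - of_real (Re (p z ^ Suc n * (A * z ^ m)))) \<in> O[at 0](\<lambda>z. p z ^ Suc n * z ^ (l - 1))"
    by (rule sum_in_bigo)
  then have "(\<lambda>z. of_real (P (W \<zeta> z) - P z)) \<in> O[at 0](\<lambda>z. p z ^ Suc n * z ^ (l - 1))" by simp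
  then obtain C1 where C1: "C1 > 0" "\<forall>\<^sub>F z in at 0. cmod (of_real (P (W \<zeta> z) - P z)) \<le> C1 * cmod (p z ^ Suc n * z ^ (l - 1))"
    by (rule landau_o.bigE)
  obtain C2 where C2: "C2 > 0" "\<forall>\<^sub>F z in at 0. cmod (of_real ((cmod (W \<zeta> z))\<^sup>2 - (cmod z)\<^sup>2
       - 2 * Re (cnj z * (p z ^ n * (B * z ^ l))))) \<le> C2 * cmod (p z ^ n * z ^ (l + 2))"
    using norm_sq_expansion[OF d2 nl] by (rule landau_o.bigE)
  obtain C3 where C3: "C3 > 0" "\<forall>\<^sub>F z in at 0. cmod (D2 \<zeta> z) \<le> C3 * cmod (z ^ 2)"
    using landau_o.big_trans[OF D2_bigo[OF d2] p_power_mult_bigo_id[OF nl]] by (rule landau_o.bigE)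
  define w where "w = (\<lambda>s. W \<zeta> (of_real s * \<omega>))"
  define q where "q = (\<lambda>s. P (of_real s) ^ n * s ^ Suc l)"
  have small: "\<forall>\<^sub>F s in at_right 0. 0 < s \<and> s < 1 \<and> s < \<epsilon> \<and> C2 * s < \<bar>\<kappa>\<bar>"
  proof -
    have "\<forall>\<^sub>F s in at_right 0. s \<in> {0<..<min (min 1 \<epsilon>) (\<bar>\<kappa>\<bar> / C2)}"
      using eps C2(1) \<open>\<kappa> \<noteq> 0\<close> by (intro eventually_at_right_real) auto
    then show ?thesis by eventually_elim (use C2(1) in \<open>auto simp: field_simps\<close>)
  qed
  have norm: "\<forall>\<^sub>F s in at_right 0. q s > 0 \<and> \<bar>(cmod (w s))\<^sup>2 - s\<^sup>2 - 2 * (q s * \<kappa>)\<bar> < q s * \<bar>\<kappa>\<bar>"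
    using small eventually_along_ray[OF \<omega>(1) C2(2)]
  proof eventually_elim
    case (elim s)
    define z where "z = of_real s * \<omega>"
    have Pz: "P z = P (of_real s)" unfolding z_def using elim \<omega> by (intro P_ray) auto
    have zs: "cmod z = s" using \<omega>(1) elim by (simp add: z_def norm_mult)
    have "P (of_real s) > 0" using elim by (intro P_pos) auto
    then have q: "q s > 0" using elim by (simp add: q_def)
    have "cnj z * (p z ^ n * (B * z ^ l)) = of_real (P z ^ n * s ^ Suc l) * (cnj \<omega> * (B * \<omega> ^ l))"
      by (simp add: z_def power_mult_distrib mult_ac)
    then have "Re (cnj z * (p z ^ n * (B * z ^ l))) = q s * \<kappa>"
      by (simp only: Re_of_real_mult Pz q_def \<kappa>_def)
    then have "\<bar>(cmod (w s))\<^sup>2 - s\<^sup>2 - 2 * (q s * \<kappa>)\<bar> \<le> C2 * cmod (p z ^ n * z ^ (l + 2))"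
      using elim(2) unfolding z_def[symmetric] norm_of_real zs w_def by simp
    also have "\<dots> = q s * (C2 * s)"
      using zs \<open>P (of_real s) > 0\<close> by (simp add: norm_mult norm_power Pz q_def mult_ac)
    also have "\<dots> < q s * \<bar>\<kappa>\<bar>" using q elim by (intro mult_strict_left_mono) auto
    finally show ?case using q by simp
  qed
  show False
  proof (rule no_radial_drift[OF \<open>\<kappa> \<noteq> 0\<close>, of w "C1 / \<bar>\<kappa>\<bar>"])
    show "\<forall>\<^sub>F s in at_right 0. 0 < \<kappa> * ((cmod (w s))\<^sup>2 - s\<^sup>2)"
      using norm
    proof eventually_elim
      case (elim s)
      define e where "e = (cmod (w s))\<^sup>2 - s\<^sup>2 - 2 * (q s * \<kappa>)"
      have "\<bar>\<kappa> * e\<bar> < \<bar>\<kappa>\<bar> * (q s * \<bar>\<kappa>\<bar>)"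
        using elim \<open>\<kappa> \<noteq> 0\<close> unfolding abs_mult e_def by (intro mult_strict_left_mono) auto
      also have "\<bar>\<kappa>\<bar> * (q s * \<bar>\<kappa>\<bar>) = q s * \<kappa>\<^sup>2" by (simp add: power2_eq_square abs_mult_self_eq mult_ac flip: abs_mult)
      finally have "- (q s * \<kappa>\<^sup>2) < \<kappa> * e" by linarith
      moreover have "\<kappa> * ((cmod (w s))\<^sup>2 - s\<^sup>2) = 2 * (q s * \<kappa>\<^sup>2) + \<kappa> * e"
        by (simp add: e_def power2_eq_square algebra_simps)
      moreover have "q s * \<kappa>\<^sup>2 > 0" using elim \<open>\<kappa> \<noteq> 0\<close> by simp
      ultimately show ?case by linarith
    qed
    show "\<forall>\<^sub>F s in at_right 0. s\<^sup>2 * \<bar>P (w s) - P (of_real s)\<bar>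
        \<le> C1 / \<bar>\<kappa>\<bar> * P (of_real s) * \<bar>(cmod (w s))\<^sup>2 - s\<^sup>2\<bar>"
      using norm small eventually_along_ray[OF \<omega>(1) C1(2)]
    proof eventually_elim
      case (elim s)
      define z where "z = of_real s * \<omega>"
      have Pz: "P z = P (of_real s)" unfolding z_def using elim \<omega> by (intro P_ray) auto
      have zs: "cmod z = s" using \<omega>(1) elim by (simp add: z_def norm_mult)
      have P0: "P (of_real s) > 0" using elim by (intro P_pos) auto
      have "s\<^sup>2 * \<bar>P (w s) - P (of_real s)\<bar> \<le> s\<^sup>2 * (C1 * (P (of_real s) ^ Suc n * s ^ (l - 1)))"
        using elim(3) P0 zs unfolding z_def[symmetric] norm_of_real norm_mult norm_power Pz w_def
        by (intro mult_left_mono) auto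
      also have "\<dots> = C1 * P (of_real s) * (P (of_real s) ^ n * (s\<^sup>2 * s ^ (l - 1)))" by (simp add: mult_ac)
      also have "\<dots> \<le> C1 * P (of_real s) * q s"
      proof -
        have "s\<^sup>2 * s ^ (l - 1) \<le> s ^ Suc l"
          unfolding power_add[symmetric] using elim by (intro power_decreasing) auto
        then show ?thesis unfolding q_def using C1(1) P0 by (intro mult_left_mono) auto
      qed
      also have "\<dots> = C1 / \<bar>\<kappa>\<bar> * P (of_real s) * (q s * \<bar>\<kappa>\<bar>)"
        using \<open>\<kappa> \<noteq> 0\<close> by simp
      also have "\<dots> \<le> C1 / \<bar>\<kappa>\<bar> * P (of_real s) * \<bar>(cmod (w s))\<^sup>2 - s\<^sup>2\<bar>"
      proof -
        have "\<bar>2 * (q s * \<kappa>)\<bar> = 2 * (q s * \<bar>\<kappa>\<bar>)" using elim by (simp add: abs_mult)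
        then have "q s * \<bar>\<kappa>\<bar> \<le> \<bar>(cmod (w s))\<^sup>2 - s\<^sup>2\<bar>" using elim(1) by linarith
        then show ?thesis using C1(1) P0 by (intro mult_left_mono) auto
      qed
      finally show ?case .
    qed
    have "((\<lambda>s. cmod (w s) / s - 1) \<longlongrightarrow> 0) (at_right 0)"
    proof (rule Lim_null_comparison)
      show "\<forall>\<^sub>F s in at_right 0. norm (cmod (w s) / s - 1) \<le> C3 * s"
        using small eventually_along_ray[OF \<omega>(1) C3(2)]
      proof eventually_elim
        case (elim s)
        define z where "z = of_real s * \<omega>"
        have zs: "cmod z = s" using \<omega>(1) elim by (simp add: z_def norm_mult)
        have "\<bar>cmod (w s) - cmod z\<bar> \<le> cmod (D2 \<zeta> z)"
          using norm_triangle_ineq3[of "w s" z] by (simp add: w_def z_def)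
        also have "\<dots> \<le> C3 * s\<^sup>2" using elim(2) zs unfolding z_def[symmetric] norm_power by simp
        finally have "\<bar>cmod (w s) - s\<bar> / s \<le> C3 * s\<^sup>2 / s" using elim zs by (intro divide_right_mono) auto
        also have "\<bar>cmod (w s) - s\<bar> / s = \<bar>cmod (w s) / s - 1\<bar>" using elim by (simp add: field_simps abs_if)
        finally show ?case using elim by (simp add: power2_eq_square)
      qed
      show "((\<lambda>s. C3 * s) \<longlongrightarrow> 0) (at_right 0)" by (intro tendsto_eq_intros) auto
    qed
    then have "((\<lambda>s. cmod (w s) / s - 1 + 1) \<longlongrightarrow> 0 + 1) (at_right 0)" by (intro tendsto_add) auto
    then have "((\<lambda>s. cmod (w s) / s) \<longlongrightarrow> 1) (at_right 0)" by simp
    from tendsto_power[OF this, of 2] show "((\<lambda>s. (cmod (w s) / s)\<^sup>2) \<longlongrightarrow> 1) (at_right 0)" by simp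
  qed
qed

lemma eventually_isCont_W: "\<forall>\<^sub>F z in at 0. isCont (W \<zeta>) z"
proof -
  have "open {v::complex \<times> complex. cmod (fst v) < r \<and> cmod (snd v) < r \<and> \<bar>Im (fst v)\<bar> < \<delta>}"
    by (intro open_Collect_conj open_Collect_less continuous_intros)
  then have "\<forall>\<^sub>F v in nhds (0, 0). v \<in> {v::complex \<times> complex. cmod (fst v) < r \<and> cmod (snd v) < r \<and> \<bar>Im (fst v)\<bar> < \<delta>}"
    using r_pos del by (intro eventually_nhds_in_open) auto
  from eventually_test_points[OF this, of \<zeta>] eventually_small[OF eps] show ?thesis
  proof eventually_elim
    case (elim z)
    have Pz: "isCont P z" using elim by (intro isCont_P) auto
    have "isCont (\<lambda>z. (z, Im \<zeta> * P z)) z" by (intro continuous_intros Pz)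
    moreover have "isCont Q (z, Im \<zeta> * P z)" using elim by (intro isCont_Q) (auto simp: Im_Z)
    ultimately have "isCont (\<lambda>z. Q (z, Im \<zeta> * P z)) z" by (rule isCont_o2)
    then have "isCont (Z \<zeta>) z" unfolding Z_def by (intro continuous_intros Pz)
    then have pair: "isCont (\<lambda>z. (Z \<zeta> z, z)) z" by (intro continuous_intros)
    have "open (ball 0 r \<times> ball (0::complex) r)" by (intro open_Times) auto
    moreover have "continuous_on (ball 0 r \<times> ball 0 r) (\<lambda>(x, y). g2 x y)"
      using cont2 by (rule continuous_on_subset) auto
    ultimately have "isCont (\<lambda>(x, y). g2 x y) (Z \<zeta> z, z)"
      using elim by (subst (asm) continuous_on_eq_continuous_at) auto
    from isCont_o2[OF pair this] show ?case by (intro continuous_intros) auto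
  qed
qed

text \<open>To leading order \<open>(cmod (W \<zeta> z))\<^sup>2 - (cmod z)\<^sup>2\<close> is a positive multiple of \<open>Re (B * z ^ j)\<close>. Near a direction
in which the latter changes sign, every small circle therefore contains a point with
\<open>cmod (W \<zeta> z) = cmod z\<close> exactly. There \<open>P\<close> does not change, by radial symmetry, and so \<open>Re (A * z ^ m)\<close>
would have to be \<open>O(z ^ Suc m)\<close>, although it is not small near that direction.\<close>

lemma first_component_not_dominant:
  assumes \<zeta>: "Re \<zeta> = -1"
    and AB: "A \<noteq> 0" "B \<noteq> 0" "m < j" "m = 0 \<Longrightarrow> Re A \<noteq> 0"
    and d1: "(\<lambda>z. D1 \<zeta> z - p z ^ Suc n * (A * z ^ m)) \<in> O[at 0](\<lambda>z. p z ^ Suc n * z ^ Suc m)"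
    and d2: "(\<lambda>z. D2 \<zeta> z - p z ^ n * (B * z ^ Suc j)) \<in> O[at 0](\<lambda>z. p z ^ n * z ^ Suc (Suc j))"
  shows False
proof -
  have j: "j > 0" using AB by simp
  obtain \<theta> \<sigma> :: real where \<sigma>: "\<sigma> = 1 \<or> \<sigma> = -1"
    and cross: "\<And>x. Re (B * cis (real j * (\<theta> + x))) = \<sigma> * (cmod B * sin (real j * x))"
    and A\<theta>: "Re (A * cis (real m * \<theta>)) \<noteq> 0"
    using exists_sign_change_direction[OF AB] by metis
  define c where "c = \<bar>Re (A * cis (real m * \<theta>))\<bar> / 2"
  have "c > 0" using A\<theta> by (simp add: c_def)
  obtain d0 where d0: "d0 > 0" "\<And>x. \<bar>x\<bar> < d0 \<Longrightarrow> \<bar>Re (A * cis (real m * (\<theta> + x)))\<bar> > c"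
  proof -
    define f where "f = (\<lambda>x. \<bar>Re (A * cis (real m * (\<theta> + x)))\<bar>)"
    have "isCont f 0"
      unfolding f_def cis_conv_exp by (intro continuous_intros isCont_Re)
    then have "(f \<longlongrightarrow> f 0) (nhds 0)"
      using isCont_def tendsto_at_iff_tendsto_nhds by blast
    then have "\<forall>\<^sub>F x in nhds 0. f x > c"
      by (rule order_tendstoD) (use A\<theta> in \<open>simp add: c_def f_def\<close>)
    then show ?thesis using that unfolding eventually_nhds_metric dist_real_def f_def by auto
  qed
  \<comment> \<open>For this \<open>d\<close> the real part of \<open>B * z ^ j\<close> has opposite signs at the angles \<open>\<theta> - d\<close> and \<open>\<theta> + d\<close>, while
    that of \<open>A * z ^ m\<close> stays away from \<open>0\<close> in between.\<close>
  define d where "d = min (d0 / 2) (pi / (2 * real j))"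
  have d: "d > 0" "d < d0" "real j * d < pi"
  proof -
    show "d > 0" "d < d0" using d0 j by (auto simp: d_def)
    have "real j * d \<le> real j * (pi / (2 * real j))" by (intro mult_left_mono) (auto simp: d_def)
    also have "\<dots> < pi" using j by simp
    finally show "real j * d < pi" .
  qed
  define S where "S = cmod B * sin (real j * d)"
  have "S > 0" unfolding S_def using d j AB by (intro mult_pos_pos sin_gt_zero) auto
  obtain C1 where C1: "C1 > 0" "\<forall>\<^sub>F z in at 0. cmod (p (W \<zeta> z) - p z + of_real (Re (p z ^ Suc n * (A * z ^ m))))
       \<le> C1 * cmod (p z ^ Suc n * z ^ Suc m)"
  proof -
    have "(\<lambda>z. p (W \<zeta> z) - p z + of_real (Re (p z ^ Suc n * (A * z ^ m)))) \<in> O[at 0](\<lambda>z. p z ^ Suc n * z ^ Suc m)"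
      by (rule defect_estimate_power[OF \<zeta> d1 D2_bigo[OF d2]]) (use AB in auto)
    then show ?thesis using that by (rule landau_o.bigE)
  qed
  obtain C2 where C2: "C2 > 0" "\<forall>\<^sub>F z in at 0. cmod (of_real ((cmod (W \<zeta> z))\<^sup>2 - (cmod z)\<^sup>2
       - 2 * Re (cnj z * (p z ^ n * (B * z ^ Suc j))))) \<le> C2 * cmod (p z ^ n * z ^ (Suc j + 2))"
    using norm_sq_expansion[OF d2] j by (auto elim: landau_o.bigE)
  have "\<forall>\<^sub>F z in at 0. cmod (p (W \<zeta> z) - p z + of_real (Re (p z ^ Suc n * (A * z ^ m)))) \<le> C1 * cmod (p z ^ Suc n * z ^ Suc m)
      \<and> cmod (of_real ((cmod (W \<zeta> z))\<^sup>2 - (cmod z)\<^sup>2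
       - 2 * Re (cnj z * (p z ^ n * (B * z ^ Suc j))))) \<le> C2 * cmod (p z ^ n * z ^ (Suc j + 2))
      \<and> isCont (W \<zeta>) z \<and> (Z \<zeta> z + D1 \<zeta> z, W \<zeta> z) \<in> M \<and> cmod z < \<epsilon>"
    using C1(2) C2(2) eventually_isCont_W eventually_image_in_M[OF \<zeta>] eventually_small[OF eps]
    by eventually_elim simp
  then obtain \<rho> where \<rho>: "\<rho> > 0" and near: "\<And>z. z \<noteq> 0 \<Longrightarrow> cmod z < \<rho> \<Longrightarrow>
      cmod (p (W \<zeta> z) - p z + of_real (Re (p z ^ Suc n * (A * z ^ m)))) \<le> C1 * cmod (p z ^ Suc n * z ^ Suc m)
      \<and> cmod (of_real ((cmod (W \<zeta> z))\<^sup>2 - (cmod z)\<^sup>2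
       - 2 * Re (cnj z * (p z ^ n * (B * z ^ Suc j))))) \<le> C2 * cmod (p z ^ n * z ^ (Suc j + 2))
      \<and> isCont (W \<zeta>) z \<and> (Z \<zeta> z + D1 \<zeta> z, W \<zeta> z) \<in> M \<and> cmod z < \<epsilon>"
    unfolding eventually_at dist_0_norm dist_norm diff_zero by blast
  \<comment> \<open>On circles of radius less than \<open>S / C2\<close> the error of the squared modulus does not affect its sign change;
    a radius less than \<open>c / C1\<close> makes the final estimate contradictory.\<close>
  define e where "e = min \<rho> (min (S / C2) (c / C1))"
  define s where "s = e / 2"
  have s: "0 < s" "s < \<rho>" "C2 * s < 2 * S" "C1 * s < c"
  proof -
    have "0 < e" unfolding e_def using \<rho> \<open>S > 0\<close> \<open>c > 0\<close> C1 C2 by simp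
    then have "0 < s" "s < e" by (simp_all add: s_def)
    then have "0 < s" "s < \<rho>" "s < S / C2" "s < c / C1" by (simp_all add: e_def)
    then show "0 < s" "s < \<rho>" "C2 * s < 2 * S" "C1 * s < c"
      using C1(1) C2(1) \<open>S > 0\<close> by (auto simp: field_simps)
  qed
  define \<gamma> where "\<gamma> = (\<lambda>x. of_real s * cis (\<theta> + x))"
  have \<gamma>: "cmod (\<gamma> x) = s" "\<gamma> x \<noteq> 0" for x using s by (auto simp: \<gamma>_def norm_mult)
  note near\<gamma> = near[OF \<gamma>(2), unfolded \<gamma>(1), OF s(2)]
  have P\<gamma>: "P (\<gamma> x) = P (of_real s)" "P (of_real s) > 0" for x
    using P_radial[of "\<gamma> x"] P_pos[of "of_real s"] near\<gamma>[of x] \<gamma>[of x] s by auto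
  define N where "N = (\<lambda>x. \<sigma> * ((cmod (W \<zeta> (\<gamma> x)))\<^sup>2 - s\<^sup>2))"
  define q where "q = P (of_real s) ^ n * s ^ (j + 2)"
  have "q > 0" using P\<gamma> s by (simp add: q_def)
  have N_approx: "\<bar>N x - 2 * q * (cmod B * sin (real j * x))\<bar> < 2 * q * S" for x
  proof -
    have "cnj (\<gamma> x) * (p (\<gamma> x) ^ n * (B * \<gamma> x ^ Suc j)) = (\<gamma> x * cnj (\<gamma> x)) * (p (\<gamma> x) ^ n * (B * \<gamma> x ^ j))"
      by (simp add: mult_ac)
    also have "\<gamma> x * cnj (\<gamma> x) = of_real (s\<^sup>2)" by (simp add: complex_norm_square[symmetric] \<gamma>)
    also have "of_real (s\<^sup>2) * (p (\<gamma> x) ^ n * (B * \<gamma> x ^ j)) = of_real q * (B * cis (real j * (\<theta> + x)))"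
      unfolding P\<gamma> by (simp add: \<gamma>_def q_def power_mult_distrib Complex.DeMoivre power_add power2_eq_square mult_ac)
    finally have "Re (cnj (\<gamma> x) * (p (\<gamma> x) ^ n * (B * \<gamma> x ^ Suc j))) = q * (\<sigma> * (cmod B * sin (real j * x)))"
      by (simp only: Re_of_real_mult cross)
    then have "\<bar>(cmod (W \<zeta> (\<gamma> x)))\<^sup>2 - s\<^sup>2 - 2 * (q * (\<sigma> * (cmod B * sin (real j * x))))\<bar> \<le> C2 * cmod (p (\<gamma> x) ^ n * \<gamma> x ^ (Suc j + 2))"
      using near\<gamma>[of x] unfolding norm_of_real \<gamma> by simp
    also have "\<dots> = q * (C2 * s)"
      using P\<gamma> s \<gamma>(1)[of x] by (simp add: norm_mult norm_power q_def)
    also have "\<dots> < q * (2 * S)" using \<open>q > 0\<close> s by (intro mult_strict_left_mono) auto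
    finally show ?thesis using \<sigma> by (auto simp: N_def algebra_simps)
  qed
  have "N (-d) < 0" "N d > 0"
    using N_approx[of d] N_approx[of "-d"] by (simp_all add: S_def abs_less_iff)
  moreover have "continuous_on {-d..d} N"
  proof (rule continuous_at_imp_continuous_on, rule ballI)
    fix x
    have "isCont \<gamma> x" unfolding \<gamma>_def cis_conv_exp by (intro continuous_intros)
    moreover have "isCont (W \<zeta>) (\<gamma> x)" using near\<gamma> by blast
    ultimately have "isCont (\<lambda>x. W \<zeta> (\<gamma> x)) x" by (rule isCont_o2)
    moreover define w where "w = (\<lambda>x. W \<zeta> (\<gamma> x))"
    ultimately have w: "isCont w x" by simp
    have "N = (\<lambda>x. \<sigma> * ((cmod (w x))\<^sup>2 - s\<^sup>2))" by (simp add: N_def w_def)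
    then show "isCont N x" using w by (auto intro!: continuous_intros)
  qed
  ultimately obtain x where x: "- d \<le> x" "x \<le> d" "N x = 0"
    using IVT'[of N "-d" 0 d] d by auto
  have "(cmod (W \<zeta> (\<gamma> x)))\<^sup>2 = s\<^sup>2" using x(3) \<sigma> by (auto simp: N_def)
  then have "cmod (W \<zeta> (\<gamma> x)) = s" using s by (simp add: power2_eq_iff_nonneg)
  moreover have "cmod (W \<zeta> (\<gamma> x)) < \<epsilon>" using near\<gamma>[of x] by (simp add: M_def)
  ultimately have PW: "P (W \<zeta> (\<gamma> x)) = P (\<gamma> x)"
    using P_radial[of "W \<zeta> (\<gamma> x)"] P\<gamma> by simp
  have "p (\<gamma> x) ^ Suc n * (A * \<gamma> x ^ m) = of_real (P (of_real s) ^ Suc n * s ^ m) * (A * cis (real m * (\<theta> + x)))"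
    unfolding P\<gamma> by (simp add: \<gamma>_def power_mult_distrib Complex.DeMoivre mult_ac)
  then have "Re (p (\<gamma> x) ^ Suc n * (A * \<gamma> x ^ m)) = P (of_real s) ^ Suc n * s ^ m * Re (A * cis (real m * (\<theta> + x)))"
    by (simp only: Re_of_real_mult)
  then have "P (of_real s) ^ Suc n * s ^ m * \<bar>Re (A * cis (real m * (\<theta> + x)))\<bar> = cmod (of_real (Re (p (\<gamma> x) ^ Suc n * (A * \<gamma> x ^ m))))"
    using P\<gamma>(2) s unfolding norm_of_real by (simp add: abs_mult)
  also have "\<dots> \<le> C1 * cmod (p (\<gamma> x) ^ Suc n * \<gamma> x ^ Suc m)"
    using near\<gamma>[of x] unfolding PW by simp
  also have "\<dots> = P (of_real s) ^ Suc n * s ^ m * (C1 * s)"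
    using P\<gamma> s \<gamma>(1)[of x] by (simp add: norm_mult norm_power)
  finally have "\<bar>Re (A * cis (real m * (\<theta> + x)))\<bar> \<le> C1 * s"
    using P\<gamma>(2) s by (simp add: mult_le_cancel_left)
  moreover have "\<bar>x\<bar> < d0" using x d by linarith
  ultimately show False using d0(2)[of x] s by linarith
qed

text \<open>A displacement of size \<open>O(P ^ Suc n)\<close> changes \<open>P\<close> only by \<open>O(z ^ N * P ^ Suc n)\<close> for every \<open>N\<close>, so nothing
balances the leading term of the first component.\<close>

lemma second_component_not_negligible:
  assumes \<zeta>: "Re \<zeta> = -1" and \<omega>: "cmod \<omega> = 1" "Re (A * \<omega> ^ m) \<noteq> 0"
    and d1: "(\<lambda>z. D1 \<zeta> z - p z ^ Suc n * (A * z ^ m)) \<in> O[at 0](\<lambda>z. p z ^ Suc n * z ^ Suc m)"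
    and d2: "D2 \<zeta> \<in> O[at 0](\<lambda>z. p z ^ Suc n)"
  shows False
proof (rule leading_term_not_small[OF \<omega>])
  have "(\<lambda>z. p z ^ n * p z) \<in> O[at 0](\<lambda>z. p z ^ n * z ^ Suc m)"
    by (intro landau_o.big.mult landau_o.big_refl p_bigo)
  then have "D2 \<zeta> \<in> O[at 0](\<lambda>z. p z ^ n * z ^ Suc m)"
    using landau_o.big_trans[OF d2] by (simp add: mult.commute)
  then have 1: "(\<lambda>z. p (W \<zeta> z) - p z + of_real (Re (p z ^ Suc n * (A * z ^ m)))) \<in> O[at 0](\<lambda>z. p z ^ Suc n * z ^ Suc m)"
    by (intro defect_estimate_power[OF \<zeta> d1, where l = "Suc m"]) auto
  have "(\<lambda>z. p z ^ Suc n) \<in> O[at 0](\<lambda>z. z)"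
    using p_power_mult_bigo_id[of "Suc n" 1 0] by simp
  from landau_o.big_trans[OF d2 this] have "W \<zeta> \<in> O[at 0](\<lambda>z. z)" by (intro sum_in_bigo) auto
  from P_diff_bigo[OF this, of "\<lambda>z. p z ^ Suc n" "Suc m"] d2
  have 2: "(\<lambda>z. p (W \<zeta> z) - p z) \<in> O[at 0](\<lambda>z. p z ^ Suc n * z ^ Suc m)" by (simp add: mult_ac)
  from sum_in_bigo(2)[OF 1 2]
  show "(\<lambda>z. of_real (Re (p z ^ Suc n * (A * z ^ m)))) \<in> O[at 0](\<lambda>z. p z ^ Suc n * z ^ Suc m)" by simp
qed

end

section \<open>Terms of order zero and one\<close>

context hypersurface_map
begin

lemma coeff1_holomorphic: "fst_coeff g1 k holomorphic_on ball 0 r"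
  by (rule fst_coeff_holomorphic[where F = g1, OF r_pos hol1_fst hol1_snd bd1])

lemma coeff2_holomorphic: "fst_coeff g2 k holomorphic_on ball 0 r"
  by (rule fst_coeff_holomorphic[where F = g2, OF r_pos hol2_fst hol2_snd bd2])

lemma D1_bigo_id: "D1 \<zeta> \<in> O[at 0](\<lambda>z. z)"
proof -
  have "(\<lambda>z. D1 \<zeta> z - (\<Sum>j<1. fst_coeff g1 j z * Z \<zeta> z ^ j)) \<in> O[at 0](\<lambda>z. p z ^ 1)"
    by (rule remainder1)
  then have "(\<lambda>z. D1 \<zeta> z - g1 0 z) \<in> O[at 0](\<lambda>z. z)"
    using landau_o.big_trans[OF _ p_bigo_id] by (simp add: fst_coeff_0)
  moreover have "g1 0 \<in> O[at 0](\<lambda>z. z)"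
    using holomorphic_taylor_bigo[OF r_pos coeff1_holomorphic[of 0], of 1] by (simp add: fst_coeff_0 g1_0)
  ultimately have "(\<lambda>z. (D1 \<zeta> z - g1 0 z) + g1 0 z) \<in> O[at 0](\<lambda>z. z)" by (rule sum_in_bigo)
  then show ?thesis by simp
qed

lemma D2_bigo_id: "D2 \<zeta> \<in> O[at 0](\<lambda>z. z)"
proof -
  have "(\<lambda>z. D2 \<zeta> z - (\<Sum>j<1. fst_coeff g2 j z * Z \<zeta> z ^ j)) \<in> O[at 0](\<lambda>z. p z ^ 1)"
    by (rule remainder2)
  then have "(\<lambda>z. D2 \<zeta> z - g2 0 z) \<in> O[at 0](\<lambda>z. z)"
    using landau_o.big_trans[OF _ p_bigo_id] by (simp add: fst_coeff_0)
  moreover have "g2 0 \<in> O[at 0](\<lambda>z. z)"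
    using holomorphic_taylor_bigo[OF r_pos coeff2_holomorphic[of 0], of 1] by (simp add: fst_coeff_0 g2_0)
  ultimately have "(\<lambda>z. (D2 \<zeta> z - g2 0 z) + g2 0 z) \<in> O[at 0](\<lambda>z. z)" by (rule sum_in_bigo)
  then show ?thesis by simp
qed

text \<open>Otherwise \<open>g1 (Z, z)\<close> is \<open>c * z ^ m\<close> to leading order, while every other term of the equation of \<open>M\<close> at
the image point is \<open>O(z ^ Suc m)\<close>, the values of \<open>P\<close> because \<open>P\<close> is flat.\<close>

lemma g1_vanishes_on_axis:
  assumes "y \<in> ball 0 r"
  shows "g1 0 y = 0"
proof (rule ccontr)
  assume "g1 0 y \<noteq> 0"
  then have nz: "\<not> (\<forall>y\<in>ball 0 r. fst_coeff g1 0 y = 0)" using assms by (auto simp: fst_coeff_0)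
  obtain m c where c: "c \<noteq> 0" "c = (deriv ^^ m) (fst_coeff g1 0) 0 / fact m"
      and lead: "(\<lambda>y. fst_coeff g1 0 y - c * y ^ m) \<in> O[at 0](\<lambda>y. y ^ Suc m)"
    using holomorphic_leading_term[OF r_pos coeff1_holomorphic nz] by blast
  have "m \<noteq> 0" using c by (auto simp: fst_coeff_0 g1_0 intro: gr0I)
  obtain \<omega> where \<omega>: "cmod \<omega> = 1" "Re (c * \<omega> ^ m) \<noteq> 0"
    using exists_unit_direction[of c m] c \<open>m \<noteq> 0\<close> by auto
  let ?\<zeta> = "-1 :: complex"
  have d1: "(\<lambda>z. D1 ?\<zeta> z - c * z ^ m) \<in> O[at 0](\<lambda>z. z ^ Suc m)"
    using expansion1[OF _ lead, where \<zeta> = ?\<zeta>] by simp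
  have L: "(\<lambda>z. p (W ?\<zeta> z) - p z + of_real (Re (c * z ^ m))) \<in> O[at 0](\<lambda>z. z ^ Suc m)"
  proof (rule defect_estimate[OF _ d1 _ D1_bigo_id D2_bigo_id])
    show "(\<lambda>z. c * z ^ m * z) \<in> O[at 0](\<lambda>z. z ^ Suc m)" using c by (simp add: mult_ac)
    have "(\<lambda>z. p z * D2 ?\<zeta> z) \<in> O[at 0](\<lambda>z. z ^ m * z)"
      by (intro landau_o.big.mult p_bigo D2_bigo_id)
    then show "(\<lambda>z. p z * D2 ?\<zeta> z) \<in> O[at 0](\<lambda>z. z ^ Suc m)" by (simp only: power_Suc2)
  qed simp
  have "W ?\<zeta> \<in> O[at 0](\<lambda>z. z)" using D2_bigo_id by (intro sum_in_bigo) auto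
  then have "(\<lambda>z. p (W ?\<zeta> z) - p z) \<in> O[at 0](\<lambda>z. z ^ m * z)"
    by (rule P_diff_bigo) (use D2_bigo_id in simp)
  then have "(\<lambda>z. p (W ?\<zeta> z) - p z) \<in> O[at 0](\<lambda>z. z ^ Suc m)" by (simp only: power_Suc2)
  from sum_in_bigo(2)[OF L this]
  have "(\<lambda>z. of_real (Re (p z ^ 0 * (c * z ^ m)))) \<in> O[at 0](\<lambda>z. p z ^ 0 * z ^ Suc m)" by simp
  with \<omega> show False by (rule leading_term_not_small)
qed

lemma coeff1_0: "y \<in> ball 0 r \<Longrightarrow> fst_coeff g1 0 y = 0"
  by (simp add: fst_coeff_0 g1_vanishes_on_axis)

text \<open>At the test points the second coordinate is multiplied by about \<open>b\<close> and the value of \<open>P\<close> by about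
\<open>c0 = - Re (\<zeta> * a)\<close>, where \<open>a\<close> and \<open>b\<close> are the diagonal entries of the derivative at the origin. As \<open>P \<ge> 0\<close>
and \<open>\<zeta>\<close> is chosen with \<open>c0 \<noteq> 0\<close>, the factor \<open>c0\<close> is positive. A large power of \<open>cmod b\<close> is smaller than \<open>c0\<close> if
\<open>cmod b < 1\<close>, which is a forbidden descent, and larger than \<open>c0\<close> if \<open>cmod b > 1\<close>, which is a forbidden ascent.\<close>

lemma cmod_multiplier_eq_1:
  assumes a: "1 + fst_coeff g1 1 0 \<noteq> 0"
  shows "cmod (1 + deriv (g2 0) 0) = 1"
proof -
  define a where "a = 1 + fst_coeff g1 1 0"
  define b where "b = 1 + deriv (g2 0) 0"
  obtain \<zeta> where \<zeta>: "Re \<zeta> = -1" "Re (\<zeta> * a) \<noteq> 0"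
    using exists_abscissa[of a 1] assms by (auto simp: a_def)
  have lead1: "(\<lambda>y. fst_coeff g1 1 y - (a - 1) * y ^ 0) \<in> O[at 0](\<lambda>y. y ^ Suc 0)"
    using holomorphic_taylor_bigo[OF r_pos coeff1_holomorphic[of 1], of 1] by (simp add: a_def)
  have "(\<lambda>z. D1 \<zeta> z - p z ^ 1 * (\<zeta> ^ 1 * (a - 1) * z ^ 0)) \<in> O[at 0](\<lambda>z. p z ^ 1 * z ^ Suc 0)"
    by (rule expansion1[OF _ lead1]) (use coeff1_0 in auto)
  then have d1: "(\<lambda>z. D1 \<zeta> z - p z ^ Suc 0 * ((\<zeta> * (a - 1)) * z ^ 0)) \<in> O[at 0](\<lambda>z. p z ^ Suc 0 * z ^ Suc 0)"
    by simp
  have lead2: "(\<lambda>y. fst_coeff g2 0 y - (b - 1) * y ^ 1) \<in> O[at 0](\<lambda>y. y ^ Suc 1)"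
    using holomorphic_taylor_bigo[OF r_pos coeff2_holomorphic[of 0], of 2]
    by (simp add: b_def fst_coeff_0 g2_0 numeral_2_eq_2)
  have "(\<lambda>z. D2 \<zeta> z - p z ^ 0 * (\<zeta> ^ 0 * (b - 1) * z ^ 1)) \<in> O[at 0](\<lambda>z. p z ^ 0 * z ^ Suc 1)"
    by (rule expansion2[OF _ lead2]) simp
  then have d2: "(\<lambda>z. W \<zeta> z - b * z) \<in> O[at 0](\<lambda>z. z ^ 2)"
    by (simp add: algebra_simps numeral_2_eq_2)
  have "(\<lambda>z. p (W \<zeta> z) - p z + of_real (Re (p z ^ Suc 0 * ((\<zeta> * (a - 1)) * z ^ 0)))) \<in> O[at 0](\<lambda>z. p z ^ Suc 0 * z ^ 1)"
    by (rule defect_estimate_power[OF \<zeta>(1) d1, where l = 1]) (use D2_bigo_id in auto)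
  moreover have "p (W \<zeta> z) - p z + of_real (Re (p z ^ Suc 0 * ((\<zeta> * (a - 1)) * z ^ 0))) = of_real (P (W \<zeta> z) + P z * Re (\<zeta> * a))" for z
  proof -
    have "Re (p z ^ Suc 0 * ((\<zeta> * (a - 1)) * z ^ 0)) = P z * (Re (\<zeta> * a) + 1)"
      using \<zeta>(1) by (simp add: algebra_simps)
    then show ?thesis by (simp only: flip: of_real_add of_real_diff) (simp add: algebra_simps)
  qed
  ultimately have "(\<lambda>z. of_real (P (W \<zeta> z) + P z * Re (\<zeta> * a))) \<in> O[at 0](\<lambda>z. p z * z)"
    by (simp only: power_Suc0_right power_one_right)
  then obtain C1 where C1: "C1 > 0" "\<forall>\<^sub>F z in at 0. cmod (of_real (P (W \<zeta> z) + P z * Re (\<zeta> * a))) \<le> C1 * cmod (p z * z)"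
    by (rule landau_o.bigE)
  obtain C2 where C2: "C2 > 0" "\<forall>\<^sub>F z in at 0. cmod (W \<zeta> z - b * z) \<le> C2 * cmod (z ^ 2)"
    using d2 by (rule landau_o.bigE)
  define c0 where "c0 = - Re (\<zeta> * a)"
  define w where "w = (\<lambda>s. W \<zeta> (of_real s * 1))"
  have Pw: "\<forall>\<^sub>F s in at_right 0. 0 < s \<and> s < \<epsilon> \<and> \<bar>P (w s) - c0 * P (of_real s)\<bar> \<le> P (of_real s) * (C1 * s) \<and> P (w s) \<ge> 0"
  proof -
    have "\<forall>\<^sub>F z in at 0. P (W \<zeta> z) \<ge> 0"
      using eventually_image_in_M[OF \<zeta>(1)]
    proof eventually_elim
      case (elim z)
      then show ?case using P_pos[of "W \<zeta> z"] P_0 by (cases "W \<zeta> z = 0") (auto simp: M_def)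
    qed
    from eventually_along_ray[OF norm_one C1(2)] eventually_along_ray[OF norm_one this] eventually_at_right_real[OF eps]
    show ?thesis
    proof eventually_elim
      case (elim s)
      have "P (of_real s) > 0" using elim by (intro P_pos) auto
      then have "\<bar>P (w s) + P (of_real s) * Re (\<zeta> * a)\<bar> \<le> C1 * (P (of_real s) * s)"
        using elim unfolding norm_of_real w_def by (simp add: norm_mult del: times_complex.sel)
      moreover have "P (w s) - c0 * P (of_real s) = P (w s) + P (of_real s) * Re (\<zeta> * a)"
        by (simp add: c0_def del: times_complex.sel)
      ultimately show ?case using elim by (simp add: w_def mult_ac)
    qed
  qed
  have W_ray: "\<forall>\<^sub>F s in at_right 0. \<bar>cmod (w s) - cmod b * s\<bar> \<le> C2 * s\<^sup>2"
    using eventually_along_ray[OF norm_one C2(2)] eventually_at_right_real[OF zero_less_one]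
  proof eventually_elim
    case (elim s)
    have "\<bar>cmod (w s) - cmod (b * of_real s)\<bar> \<le> cmod (w s - b * of_real s)" by (rule norm_triangle_ineq3)
    then show ?case using elim by (simp add: w_def norm_mult norm_power)
  qed
  have tiny: "\<forall>\<^sub>F s::real in at_right 0. 0 < s \<and> C * s < e" if "C > 0" "e > 0" for C e
  proof -
    have "\<forall>\<^sub>F s in at_right 0. s \<in> {0<..<e / C}" using that by (intro eventually_at_right_real) auto
    then show ?thesis by eventually_elim (use that in \<open>auto simp: field_simps\<close>)
  qed
  have "c0 > 0"
  proof (rule ccontr)
    assume "\<not> c0 > 0"
    then have "c0 < 0" using \<zeta>(2) by (simp add: c0_def)
    have E: "0 < - c0" using \<open>c0 < 0\<close> by simp
    have "\<forall>\<^sub>F s::real in at_right 0. False"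
      using Pw tiny[OF C1(1) E]
    proof eventually_elim
      fix s assume s: "0 < s \<and> s < \<epsilon> \<and> \<bar>P (w s) - c0 * P (of_real s)\<bar> \<le> P (of_real s) * (C1 * s) \<and> P (w s) \<ge> 0"
        "0 < s \<and> C1 * s < - c0"
      then have "P (of_real s) > 0" by (intro P_pos) auto
      then have "P (of_real s) * (C1 * s) < P (of_real s) * (- c0)" using s by (intro mult_strict_left_mono) auto
      then show False using s by (auto simp: algebra_simps)
    qed
    then show False by simp
  qed
  have E: "0 < c0 / 2" using \<open>c0 > 0\<close> by simp
  have Pw2: "\<forall>\<^sub>F s in at_right 0. 0 < s \<and> P (of_real s) > 0 \<and> c0 / 2 * P (of_real s) \<le> P (w s) \<and> P (w s) \<le> 2 * c0 * P (of_real s)"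
    using Pw tiny[OF C1(1) E]
  proof eventually_elim
    fix s assume s: "0 < s \<and> s < \<epsilon> \<and> \<bar>P (w s) - c0 * P (of_real s)\<bar> \<le> P (of_real s) * (C1 * s) \<and> P (w s) \<ge> 0"
        "0 < s \<and> C1 * s < c0 / 2"
    then have P: "P (of_real s) > 0" by (intro P_pos) auto
    then have "P (of_real s) * (C1 * s) \<le> P (of_real s) * (c0 / 2)" using s by (intro mult_left_mono) auto
    moreover define X where "X = c0 * P (of_real s)"
    ultimately have a: "\<bar>P (w s) - X\<bar> \<le> X / 2" using s by (simp add: mult_ac)
    have b: "X > 0" using P \<open>c0 > 0\<close> by (simp add: X_def)
    have "X / 2 \<le> P (w s)" using a by linarith
    moreover have "P (w s) \<le> 2 * X" using a b by linarith
    ultimately show "0 < s \<and> P (of_real s) > 0 \<and> c0 / 2 * P (of_real s) \<le> P (w s) \<and> P (w s) \<le> 2 * c0 * P (of_real s)"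
      using P s by (simp add: X_def)
  qed
  show ?thesis
  proof (rule ccontr)
    assume "cmod (1 + deriv (g2 0) 0) \<noteq> 1"
    then consider "cmod b < 1" | "cmod b > 1" by (fastforce simp: b_def)
    then show False
    proof cases
      case 1
      define q where "q = (cmod b + 1) / 2"
      have q: "0 < q" "q < 1" "cmod b < q" using 1 by (auto simp: q_def add_nonneg_pos)
      obtain N where N: "q ^ N < c0 / 2" using real_arch_pow_inv[of "c0 / 2" q] q \<open>c0 > 0\<close> by auto
      have E: "0 < q - cmod b" using q by simp
      have "\<forall>\<^sub>F s in at_right 0. \<exists>w. 0 < cmod w \<and> cmod w < s \<and> P w \<ge> P (of_real s) * (cmod w / s) ^ N"
        using Pw2 W_ray tiny[OF C2(1) E]
      proof eventually_elim
        fix s assume s: "0 < s \<and> P (of_real s) > 0 \<and> c0 / 2 * P (of_real s) \<le> P (w s) \<and> P (w s) \<le> 2 * c0 * P (of_real s)"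
          "\<bar>cmod (w s) - cmod b * s\<bar> \<le> C2 * s\<^sup>2" "0 < s \<and> C2 * s < q - cmod b"
        have "C2 * s * s \<le> (q - cmod b) * s" using s by (intro mult_right_mono) auto
        then have wq: "cmod (w s) \<le> q * s" using s by (auto simp: power2_eq_square algebra_simps abs_le_iff)
        then have "cmod (w s) / s \<le> q" using s by (simp add: field_simps)
        then have "(cmod (w s) / s) ^ N \<le> q ^ N" using s by (intro power_mono) auto
        then have A: "P (of_real s) * (cmod (w s) / s) ^ N \<le> c0 / 2 * P (of_real s)"
          unfolding mult.commute[of "c0 / 2"]
          using s N by (intro mult_left_mono) auto
        have B: "q * s < 1 * s" using q s by (intro mult_strict_right_mono) auto
        have "c0 / 2 * P (of_real s) > 0" using \<open>c0 > 0\<close> s by simp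
        then have "P (w s) > 0" using s by linarith
        then have "w s \<noteq> 0" using P_0 by auto
        moreover have "cmod (w s) < s" using wq B by linarith
        moreover have "P (of_real s) * (cmod (w s) / s) ^ N \<le> P (w s)" using A s by linarith
        ultimately show "\<exists>w. 0 < cmod w \<and> cmod w < s \<and> P w \<ge> P (of_real s) * (cmod w / s) ^ N"
          by (intro exI[of _ "w s"]) simp
      qed
      then show False by (rule no_descent)
    next
      case 2
      define q where "q = (cmod b + 1) / 2"
      have q: "1 < q" "q < cmod b" using 2 by (auto simp: q_def)
      obtain N where N: "2 * c0 < q ^ N" using real_arch_pow[of q] q by blast
      have E: "0 < cmod b - q" using q by simp
      have "\<forall>\<^sub>F s in at_right 0. \<exists>w. s < cmod w \<and> cmod w \<le> (2 * cmod b) * s \<and> P w \<le> P (of_real s) * (cmod w / s) ^ N"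
        using Pw2 W_ray tiny[OF C2(1) E]
      proof eventually_elim
        fix s assume s: "0 < s \<and> P (of_real s) > 0 \<and> c0 / 2 * P (of_real s) \<le> P (w s) \<and> P (w s) \<le> 2 * c0 * P (of_real s)"
          "\<bar>cmod (w s) - cmod b * s\<bar> \<le> C2 * s\<^sup>2" "0 < s \<and> C2 * s < cmod b - q"
        have le: "C2 * s * s \<le> (cmod b - q) * s" using s by (intro mult_right_mono) auto
        then have wq: "q * s \<le> cmod (w s)" using s by (auto simp: power2_eq_square algebra_simps abs_le_iff)
        have "0 \<le> q * s" using q s by simp
        then have wb: "cmod (w s) \<le> (2 * cmod b) * s" using s le by (simp add: power2_eq_square algebra_simps abs_le_iff)
        have "q \<le> cmod (w s) / s" using wq s by (simp add: field_simps)
        then have "q ^ N \<le> (cmod (w s) / s) ^ N" using q by (intro power_mono) auto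
        then have A: "2 * c0 * P (of_real s) \<le> P (of_real s) * (cmod (w s) / s) ^ N"
          unfolding mult.commute[of "2 * c0"] using s N by (intro mult_left_mono) auto
        have B: "1 * s < q * s" using q s by (intro mult_strict_right_mono) auto
        have "s < cmod (w s)" using wq B by linarith
        moreover have "P (w s) \<le> P (of_real s) * (cmod (w s) / s) ^ N" using A s by linarith
        ultimately show "\<exists>w. s < cmod w \<and> cmod w \<le> (2 * cmod b) * s \<and> P w \<le> P (of_real s) * (cmod w / s) ^ N"
          using wb by (intro exI[of _ "w s"]) simp
      qed
      then show False by (rule no_ascent)
    qed
  qed
qed

end

section \<open>Rigidity of the displacement\<close>

context hypersurface_map
begin

text \<open>The least order at which a coefficient of the displacement does not vanish leads to one of the three
dominance cases, each of which is impossible. The order in \<open>x\<close> of the first component is counted one higher,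
because a relative change of \<open>P\<close> by \<open>P ^ n\<close> has to be balanced by a change of the first coordinate
by \<open>P ^ Suc n\<close>.\<close>

lemma displacement_vanishes:
  assumes b: "deriv (g2 0) 0 = 0" and x: "cmod x \<le> r / 2" and y: "y \<in> ball 0 r"
  shows "g1 x y = 0 \<and> g2 x y = 0"
proof -
  define bad where "bad n \<longleftrightarrow> \<not> (\<forall>y\<in>ball 0 r. fst_coeff g1 (Suc n) y = 0) \<or> \<not> (\<forall>y\<in>ball 0 r. fst_coeff g2 n y = 0)" for n
  have "\<not> bad n" for n
  proof
    assume "bad n"
    then obtain n where n: "bad n" "\<And>j. j < n \<Longrightarrow> \<not> bad j"
      using exists_least_iff[of bad] by blast
    have zero1: "fst_coeff g1 j y = 0" if "j < Suc n" "y \<in> ball 0 r" for j y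
      using that n(2) coeff1_0 by (cases j) (auto simp: bad_def)
    have zero2: "fst_coeff g2 j y = 0" if "j < n" "y \<in> ball 0 r" for j y
      using that n(2) by (auto simp: bad_def)
    let ?A0 = "\<forall>y\<in>ball 0 r. fst_coeff g1 (Suc n) y = 0"
    show False
    proof (cases "\<forall>y\<in>ball 0 r. fst_coeff g2 n y = 0")
      case True
      then have "\<not> ?A0" using n(1) by (auto simp: bad_def)
      then obtain m \<alpha> where \<alpha>: "\<alpha> \<noteq> 0"
          and lead: "(\<lambda>y. fst_coeff g1 (Suc n) y - \<alpha> * y ^ m) \<in> O[at 0](\<lambda>y. y ^ Suc m)"
        using holomorphic_leading_term[OF r_pos coeff1_holomorphic] by blast
      obtain \<zeta> where \<zeta>: "Re \<zeta> = -1" "Re (\<zeta> ^ Suc n * \<alpha>) \<noteq> 0"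
        using exists_abscissa[OF \<alpha>, of "Suc n"] by auto
      show False
      proof (rule second_component_not_negligible[OF \<zeta>(1), of 1 "\<zeta> ^ Suc n * \<alpha>" m n])
        show "(\<lambda>z. D1 \<zeta> z - p z ^ Suc n * (\<zeta> ^ Suc n * \<alpha> * z ^ m)) \<in> O[at 0](\<lambda>z. p z ^ Suc n * z ^ Suc m)"
          by (rule expansion1[OF zero1 lead])
        have "\<forall>\<^sub>F z in at 0. D2 \<zeta> z - (\<Sum>j<Suc n. fst_coeff g2 j z * Z \<zeta> z ^ j) = D2 \<zeta> z"
          using eventually_small[OF r_pos] by eventually_elim (use zero2 True in simp)
        from landau_o.big.in_cong[OF this] remainder2[of \<zeta> "Suc n"]
        show "D2 \<zeta> \<in> O[at 0](\<lambda>z. p z ^ Suc n)" by blast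
      qed (use \<zeta>(2) in \<open>simp_all only: power_one mult_1_right norm_one not_False_eq_True\<close>)
    next
      case False
      then obtain l \<beta> where \<beta>: "\<beta> \<noteq> 0" "\<beta> = (deriv ^^ l) (fst_coeff g2 n) 0 / fact l"
          and lead2: "(\<lambda>y. fst_coeff g2 n y - \<beta> * y ^ l) \<in> O[at 0](\<lambda>y. y ^ Suc l)"
        using holomorphic_leading_term[OF r_pos coeff2_holomorphic] by blast
      have nl: "n \<ge> 1 \<or> l \<ge> 2"
      proof (rule ccontr)
        assume "\<not> (n \<ge> 1 \<or> l \<ge> 2)"
        then have "n = 0" "l = 0 \<or> l = 1" by auto
        then show False using \<beta> b by (auto simp: fst_coeff_0 g2_0)
      qed
      \<comment> \<open>If the first component has no term of this order, the leading coefficient \<open>0\<close> with the exponent \<open>m = l\<close>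
        puts the situation into the first case below.\<close>
      obtain m \<alpha> where m\<alpha>: "\<alpha> \<noteq> 0 \<or> m = l"
          and lead1: "(\<lambda>y. fst_coeff g1 (Suc n) y - \<alpha> * y ^ m) \<in> O[at 0](\<lambda>y. y ^ Suc m)"
      proof (cases ?A0)
        case True
        have "\<forall>\<^sub>F y in at 0. fst_coeff g1 (Suc n) y - 0 * y ^ l = 0"
          using eventually_small[OF r_pos] by eventually_elim (use True in simp)
        then have "(\<lambda>y. fst_coeff g1 (Suc n) y - 0 * y ^ l) \<in> O[at 0](\<lambda>y. y ^ Suc l)"
          by (subst landau_o.big.in_cong) auto
        then show ?thesis by (intro that[of 0 l]) simp_all
      next
        case False
        then show ?thesis using holomorphic_leading_term[OF r_pos coeff1_holomorphic] that by blast
      qed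
      note d1 = expansion1[OF zero1 lead1]
      note d2 = expansion2[OF zero2 lead2]
      show False
      proof (cases "l \<le> Suc m")
        case True
        obtain \<zeta> \<omega> where \<zeta>: "Re \<zeta> = -1" and \<omega>: "cmod \<omega> = 1" "Re (cnj \<omega> * (\<zeta> ^ n * \<beta> * \<omega> ^ l)) \<noteq> 0"
        proof (cases "n \<ge> 1")
          case True
          then show ?thesis using exists_abscissa[OF \<beta>(1) True] that[of _ 1] by (auto simp del: times_complex.sel)
        next
          case False
          then have "n = 0" "l - 1 \<ge> 1" using nl by auto
          from this(2) obtain \<omega> where \<omega>: "cmod \<omega> = 1" "Re (\<beta> * \<omega> ^ (l - 1)) \<noteq> 0"
            using exists_unit_direction[OF \<beta>(1)] by blast
          have "\<omega> * cnj \<omega> = 1" using \<omega>(1) by (simp flip: complex_norm_square)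
          moreover have "\<omega> ^ l = \<omega> * \<omega> ^ (l - 1)" using nl False by (cases l) auto
          then have "cnj \<omega> * ((-1) ^ n * \<beta> * \<omega> ^ l) = (\<omega> * cnj \<omega>) * (\<beta> * \<omega> ^ (l - 1))"
            using \<open>n = 0\<close> by (simp add: mult_ac)
          ultimately have "cnj \<omega> * ((-1) ^ n * \<beta> * \<omega> ^ l) = \<beta> * \<omega> ^ (l - 1)" by simp
          with \<omega>(2) have "Re (cnj \<omega> * ((-1) ^ n * \<beta> * \<omega> ^ l)) \<noteq> 0" by (simp only: not_False_eq_True)
          then show ?thesis using that[of "-1", OF _ \<omega>(1)] by simp
        qed
        show False
          by (rule second_component_not_dominant[OF \<zeta> \<omega> d1 d2 nl True])
      next
        case False
        then have \<alpha>: "\<alpha> \<noteq> 0" using m\<alpha> by auto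
        obtain \<zeta> where \<zeta>: "Re \<zeta> = -1" "Re (\<zeta> ^ Suc n * \<alpha>) \<noteq> 0"
          using exists_abscissa[OF \<alpha>, of "Suc n"] by auto
        then have "\<zeta> \<noteq> 0" by auto
        obtain j where j: "l = Suc j" using False by (cases l) auto
        show False
          by (rule first_component_not_dominant[OF \<zeta>(1), where n = n and m = m and j = j
                and A = "\<zeta> ^ Suc n * \<alpha>" and B = "\<zeta> ^ n * \<beta>"])
             (use d1 d2 \<open>\<zeta> \<noteq> 0\<close> \<alpha> \<beta>(1) \<zeta>(2) False j in \<open>simp_all only: mult_eq_0_iff power_eq_0_iff, auto\<close>)
      qed
    qed
  qed
  then have z1: "fst_coeff g1 j y = 0" and z2: "fst_coeff g2 j y = 0" for j
    using coeff1_0 y by (cases j; auto simp: bad_def)+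
  have van: "v = 0" if le: "\<And>n. cmod v \<le> 2 * K / r ^ n * cmod x ^ n" for v
  proof -
    have K: "K > 0" using bd1[of 0 0] r_pos by (auto intro: le_less_trans[OF norm_ge_zero])
    have "cmod v \<le> 2 * K * (1 / 2) ^ n" for n
    proof -
      have "2 * K / r ^ n * cmod x ^ n = 2 * K * (cmod x / r) ^ n" by (simp add: power_divide)
      also have "\<dots> \<le> 2 * K * (1 / 2) ^ n"
        using K x r_pos by (intro mult_left_mono power_mono) (auto simp: field_simps)
      finally show ?thesis using le[of n] by linarith
    qed
    moreover have "(\<lambda>n. 2 * K * (1 / 2) ^ n) \<longlonglongrightarrow> 0"
      by (intro tendsto_mult_right_zero LIMSEQ_power_zero) auto
    ultimately have "cmod v \<le> 0" by (intro LIMSEQ_le_const) auto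
    then show ?thesis by simp
  qed
  have y': "y \<in> cball 0 r" using y by auto
  show ?thesis
    using van[of "g1 x y"] van[of "g2 x y"]
      fst_coeff_remainder[where F = g1, OF r_pos hol1_fst bd1 x y']
      fst_coeff_remainder[where F = g2, OF r_pos hol2_fst bd2 x y'] z1 z2 by simp
qed

end

section \<open>Derivatives of germs and rotations\<close>

lemma holomorphic2_partials:
  assumes "(f has_derivative (\<lambda>(h1, h2). (a * h1 + b * h2, c * h1 + d * h2))) (at (x, y))"
  shows "((\<lambda>x. fst (f (x, y))) has_field_derivative a) (at x)"
    and "((\<lambda>x. snd (f (x, y))) has_field_derivative c) (at x)"
    and "((\<lambda>y. fst (f (x, y))) has_field_derivative b) (at y)"
    and "((\<lambda>y. snd (f (x, y))) has_field_derivative d) (at y)"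
proof -
  have X: "((\<lambda>x. (x, y)) has_derivative (\<lambda>h. (h, 0))) (at x)"
    and Y: "((\<lambda>y. (x, y)) has_derivative (\<lambda>h. (0, h))) (at y)"
    by (auto intro!: derivative_eq_intros)
  have "((\<lambda>x. f (x, y)) has_derivative (\<lambda>h. (a * h, c * h))) (at x)"
    using has_derivative_compose[OF X assms] by simp
  from has_derivative_fst[OF this] has_derivative_snd[OF this]
  show "((\<lambda>x. fst (f (x, y))) has_field_derivative a) (at x)"
    "((\<lambda>x. snd (f (x, y))) has_field_derivative c) (at x)"
    unfolding has_field_derivative_def by simp_all
  have "((\<lambda>y. f (x, y)) has_derivative (\<lambda>h. (b * h, d * h))) (at y)"
    using has_derivative_compose[OF Y assms] by simp
  from has_derivative_fst[OF this] has_derivative_snd[OF this]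
  show "((\<lambda>y. fst (f (x, y))) has_field_derivative b) (at y)"
    "((\<lambda>y. snd (f (x, y))) has_field_derivative d) (at y)"
    unfolding has_field_derivative_def by simp_all
qed

text \<open>The chain rule for the inverse map makes the derivative injective; if the determinant vanished, the
columns of the adjugate matrix would lie in its kernel, so all entries would be zero.\<close>

lemma biholomorphic2_det_nonzero:
  assumes "biholomorphic2 f U V" "v \<in> U"
    and "(f has_derivative (\<lambda>(h1, h2). (a * h1 + b * h2, c * h1 + d * h2))) (at v)"
  shows "a * d - b * c \<noteq> 0"
proof
  assume det: "a * d - b * c = 0"
  let ?D = "\<lambda>(h1, h2). (a * h1 + b * h2, c * h1 + d * h2)"
  let ?g = "inv_into U f"
  have U: "open U" and bij: "bij_betw f U V" and g: "holomorphic2_on ?g V"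
    using assms(1) by (auto simp: biholomorphic2_def)
  have "f v \<in> V" using bij assms(2) by (auto simp: bij_betw_def)
  then obtain G where G: "(?g has_derivative G) (at (f v))" using g unfolding holomorphic2_on_def by blast
  have inv: "?g (f u) = u" if "u \<in> U" for u
    using that bij by (auto simp: bij_betw_def)
  have "((\<lambda>u. ?g (f u)) has_derivative (\<lambda>h. G (?D h))) (at v)"
    by (rule has_derivative_compose[OF assms(3) G])
  then have "((\<lambda>u. u) has_derivative (\<lambda>h. G (?D h))) (at v)"
    by (rule has_derivative_transform_within_open[OF _ U assms(2)]) (simp add: inv)
  then have id: "G (?D h) = h" for h
    using fun_cong[OF has_derivative_unique[OF _ has_derivative_ident]] by blast
  have G0: "G (0, 0) = (0, 0)"
    using linear_0[OF has_derivative_linear[OF G]] by (simp add: zero_prod_def)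
  have ker: "h = (0, 0)" if "?D h = (0, 0)" for h
    using id[of h] unfolding that G0 by (rule sym)
  have "?D (d, - c) = (0, 0)" "?D (- b, a) = (0, 0)" using det by (simp_all add: algebra_simps)
  from ker[OF this(1)] ker[OF this(2)] have "a = 0" "c = 0" by simp_all
  then have "?D (1, 0) = (0, 0)" by simp
  from ker[OF this] show False by simp
qed

lemma rotation_eq: "rotation t = (\<lambda>v. (fst v, snd v * exp (\<i> * of_real t)))"
  by (auto simp: rotation_def)

lemma holomorphic2_on_rotation: "holomorphic2_on (rotation t) S"
  unfolding holomorphic2_on_def
proof (intro ballI exI)
  fix v :: "complex \<times> complex"
  show "(rotation t has_derivative (\<lambda>(h1, h2). (1 * h1 + 0 * h2, 0 * h1 + exp (\<i> * of_real t) * h2))) (at v)"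
    unfolding rotation_eq by (auto intro!: derivative_eq_intros simp: fun_eq_iff)
qed

lemma biholomorphic2_rotation: "biholomorphic2 (rotation t) UNIV UNIV"
proof -
  have inv: "rotation t (rotation (- t) v) = v" "rotation (- t) (rotation t v) = v" for v
    by (simp_all add: rotation_eq mult.assoc flip: exp_add)
  then have bij: "bij (rotation t)" by (metis bijI')
  have "inv (rotation t) = rotation (- t)" using inv by (intro inv_equality)
  with bij show ?thesis unfolding biholomorphic2_def by (simp add: holomorphic2_on_rotation)
qed

section \<open>The stability group\<close>

context infinite_type_hypersurface
begin

lemma M_rotate:
  assumes "(x, y) \<in> M" "cmod c = 1"
  shows "(x, c * y) \<in> M"
proof -
  have n: "cmod (c * y) = cmod y" using assms by (simp add: norm_mult)
  have *: "cmod y < \<epsilon>" "Im x \<in> {-\<delta><..<\<delta>}" "Re x + P y + Im x * Q (y, Im x) = 0"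
    using assms(1) by (auto simp: M_def)
  have "P (c * y) = P y" using P_radial[of "c * y"] P_radial[of y] * n by simp
  moreover have "Q (c * y, Im x) = Q (y, Im x)"
    using Q_radial[of "c * y" "Im x"] Q_radial[of y "Im x"] * n by simp
  ultimately show ?thesis using * n by (auto simp: M_def)
qed

text \<open>Composing with the rotation by \<open>c\<close> keeps \<open>M\<close> invariant and makes it possible to normalise the
derivative of the second component.\<close>

lemma germ_gives_hypersurface_map:
  assumes U: "open U" "0 \<in> U" and hol: "holomorphic2_on f U" and f0: "f 0 = 0"
    and pres: "\<forall>\<^sub>F v in nhds 0. v \<in> M \<longrightarrow> f v \<in> M" and c: "cmod c = 1"
  shows "\<exists>r K. hypersurface_map P Q \<epsilon> \<delta> (\<lambda>x y. fst (f (x, y)) - x) (\<lambda>x y. c * snd (f (x, y)) - y) r K"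
proof -
  obtain A B where AB: "open A" "open B" "(0, 0) \<in> A \<times> B" "A \<times> B \<subseteq> U"
    using open_prod_elim[OF U(1), of "(0, 0)"] U(2) by (auto simp: zero_prod_def)
  obtain r1 where r1: "r1 > 0" "cball 0 r1 \<subseteq> A" using AB by (auto simp: open_contains_cball)
  obtain r2 where r2: "r2 > 0" "cball 0 r2 \<subseteq> B" using AB by (auto simp: open_contains_cball)
  define r where "r = min r1 r2"
  have "cball 0 r \<subseteq> A" "cball 0 r \<subseteq> B"
    using subset_trans[OF subset_cball r1(2)] subset_trans[OF subset_cball r2(2)] by (simp_all add: r_def)
  then have "\<And>x y. x \<in> cball 0 r \<Longrightarrow> y \<in> cball 0 r \<Longrightarrow> (x, y) \<in> U"
    using AB(4) by blast
  moreover have "r > 0" using r1(1) r2(1) by (simp add: r_def)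
  ultimately have r: "r > 0" "\<And>x y. x \<in> cball 0 r \<Longrightarrow> y \<in> cball 0 r \<Longrightarrow> (x, y) \<in> U"
    by blast+
  let ?g1 = "\<lambda>x y. fst (f (x, y)) - x" and ?g2 = "\<lambda>x y. c * snd (f (x, y)) - y"
  have D: "\<exists>a b c d. (f has_derivative (\<lambda>(h1, h2). (a * h1 + b * h2, c * h1 + d * h2))) (at (x, y))"
    if "x \<in> cball 0 r" "y \<in> cball 0 r" for x y
    using hol r(2)[OF that] unfolding holomorphic2_on_def by blast
  have fd: "(\<lambda>x. fst (f (x, y))) field_differentiable (at x)" "(\<lambda>x. snd (f (x, y))) field_differentiable (at x)"
      "(\<lambda>y. fst (f (x, y))) field_differentiable (at y)" "(\<lambda>y. snd (f (x, y))) field_differentiable (at y)"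
    if xy: "x \<in> cball 0 r" "y \<in> cball 0 r" for x y
  proof -
    obtain a b c d where "(f has_derivative (\<lambda>(h1, h2). (a * h1 + b * h2, c * h1 + d * h2))) (at (x, y))"
      using D[OF xy] by blast
    from holomorphic2_partials[OF this]
    show "(\<lambda>x. fst (f (x, y))) field_differentiable (at x)" "(\<lambda>x. snd (f (x, y))) field_differentiable (at x)"
      "(\<lambda>y. fst (f (x, y))) field_differentiable (at y)" "(\<lambda>y. snd (f (x, y))) field_differentiable (at y)"
      unfolding field_differentiable_def by blast+
  qed
  have cont: "continuous_on (cball 0 r \<times> cball 0 r) f"
  proof (rule continuous_at_imp_continuous_on, rule ballI)
    fix v :: "complex \<times> complex" assume "v \<in> cball 0 r \<times> cball 0 r"
    then show "isCont f v" using D[of "fst v" "snd v"] has_derivative_continuous by auto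
  qed
  have c1: "continuous_on (cball 0 r \<times> cball 0 r) (\<lambda>v. fst (f v) - fst v)"
    and c2: "continuous_on (cball 0 r \<times> cball 0 r) (\<lambda>v. c * snd (f v) - snd v)"
    by (intro continuous_intros cont)+
  have comp: "compact (cball (0::complex) r \<times> cball (0::complex) r)" by (intro compact_Times) auto
  have "\<exists>K. \<forall>v\<in>cball 0 r \<times> cball 0 r. cmod (fst (f v) - fst v) \<le> K"
       "\<exists>K. \<forall>v\<in>cball 0 r \<times> cball 0 r. cmod (c * snd (f v) - snd v) \<le> K"
    using compact_imp_bounded[OF compact_continuous_image[OF c1 comp]]
      compact_imp_bounded[OF compact_continuous_image[OF c2 comp]] by (auto simp: bounded_iff)
  then obtain K1 K2 where K: "\<And>v. v \<in> cball 0 r \<times> cball 0 r \<Longrightarrow> cmod (fst (f v) - fst v) \<le> K1"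
      "\<And>v. v \<in> cball 0 r \<times> cball 0 r \<Longrightarrow> cmod (c * snd (f v) - snd v) \<le> K2" by blast
  have "hypersurface_map P Q \<epsilon> \<delta> ?g1 ?g2 r (max K1 K2 + 1)"
  proof (unfold_locales)
    show "r > 0" by (rule r)
    fix y :: complex assume y: "y \<in> cball 0 r"
    show "(\<lambda>x. ?g1 x y) holomorphic_on cball 0 r" "(\<lambda>x. ?g2 x y) holomorphic_on cball 0 r"
    proof -
      have h: "(\<lambda>x. fst (f (x, y))) holomorphic_on cball 0 r" "(\<lambda>x. snd (f (x, y))) holomorphic_on cball 0 r"
        unfolding holomorphic_on_def using fd[OF _ y] field_differentiable_at_within by blast+
      show "(\<lambda>x. ?g1 x y) holomorphic_on cball 0 r" "(\<lambda>x. ?g2 x y) holomorphic_on cball 0 r"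
        by (intro holomorphic_intros h)+
    qed
    show "(\<lambda>x. ?g1 y x) holomorphic_on cball 0 r" "(\<lambda>x. ?g2 y x) holomorphic_on cball 0 r"
    proof -
      have h: "(\<lambda>x. fst (f (y, x))) holomorphic_on cball 0 r" "(\<lambda>x. snd (f (y, x))) holomorphic_on cball 0 r"
        unfolding holomorphic_on_def using fd[OF y] field_differentiable_at_within by blast+
      show "(\<lambda>x. ?g1 y x) holomorphic_on cball 0 r" "(\<lambda>x. ?g2 y x) holomorphic_on cball 0 r"
        by (intro holomorphic_intros h)+
    qed
  next
    fix x y :: complex assume "x \<in> cball 0 r" "y \<in> cball 0 r"
    then show "cmod (?g1 x y) < max K1 K2 + 1" "cmod (?g2 x y) < max K1 K2 + 1"
      using K(1)[of "(x, y)"] K(2)[of "(x, y)"] by auto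
  next
    show "continuous_on (cball 0 r \<times> cball 0 r) (\<lambda>(x, y). ?g2 x y)"
      using c2 by (simp add: case_prod_unfold)
    show "?g1 0 0 = 0" "?g2 0 0 = 0" using f0 by (simp_all add: zero_prod_def)
    have "\<forall>\<^sub>F v in nhds (0, 0). v \<in> M \<longrightarrow> f v \<in> M" using pres by (simp add: zero_prod_def)
    then show "\<forall>\<^sub>F v in nhds (0, 0). v \<in> M \<longrightarrow>
        (fst v + ?g1 (fst v) (snd v), snd v + ?g2 (fst v) (snd v)) \<in> M"
      by eventually_elim (use M_rotate[OF _ c] in auto)
  qed
  then show ?thesis by blast
qed

text \<open>The displacement of \<open>f\<close> itself shows that the derivative \<open>d\<close> of the second component in the second
variable is unimodular: the first component vanishes on the axis, so the derivative of \<open>f\<close> is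
triangular and its entry \<open>a\<close> is nonzero. The displacement of \<open>f\<close> followed by the rotation by \<open>cnj d\<close> then vanishes.\<close>

lemma germ_is_rotation:
  assumes bih: "biholomorphic2 f U V" "0 \<in> U" and f0: "f 0 = 0"
    and pres: "\<forall>\<^sub>F v in nhds 0. v \<in> M \<longrightarrow> f v \<in> M"
  shows "\<exists>t. \<forall>\<^sub>F v in nhds 0. f v = rotation t v"
proof -
  have U: "open U" and hol: "holomorphic2_on f U" using bih by (auto simp: biholomorphic2_def)
  obtain a b c d where Df: "(f has_derivative (\<lambda>(h1, h2). (a * h1 + b * h2, c * h1 + d * h2))) (at (0, 0))"
    using hol bih(2) unfolding holomorphic2_on_def zero_prod_def by blast
  have det: "a * d - b * c \<noteq> 0"
  proof (rule biholomorphic2_det_nonzero[OF bih(1) _ Df])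
    show "(0, 0) \<in> U" using bih(2) by (simp add: zero_prod_def)
  qed
  note partials = holomorphic2_partials[OF Df]
  have "cmod d = 1"
  proof -
    obtain r K where "hypersurface_map P Q \<epsilon> \<delta> (\<lambda>x y. fst (f (x, y)) - x) (\<lambda>x y. 1 * snd (f (x, y)) - y) r K"
      using germ_gives_hypersurface_map[OF U bih(2) hol f0 pres, of 1] by auto
    then interpret h: hypersurface_map P Q \<epsilon> \<delta> "\<lambda>x y. fst (f (x, y)) - x" "\<lambda>x y. 1 * snd (f (x, y)) - y" r K .
    have "\<forall>\<^sub>F y in nhds 0. y \<in> ball 0 r" using h.r_pos by (intro eventually_nhds_in_open) auto
    then have "\<forall>\<^sub>F y in nhds 0. fst (f (0, y)) = 0"
      by eventually_elim (use h.g1_vanishes_on_axis in force)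
    then have "deriv (\<lambda>y. fst (f (0, y))) 0 = deriv (\<lambda>y. 0) 0" by (intro deriv_cong_ev) auto
    then have "b = 0" using DERIV_imp_deriv[OF partials(3)] by simp
    then have "a \<noteq> 0" using det by auto
    have "((\<lambda>x. fst (f (x, 0)) - x) has_field_derivative a - 1) (at 0)"
      by (rule DERIV_diff[OF partials(1) DERIV_ident])
    then have "fst_coeff (\<lambda>x y. fst (f (x, y)) - x) 1 0 = a - 1"
      by (simp add: fst_coeff_def DERIV_imp_deriv)
    moreover have "((\<lambda>y. 1 * snd (f (0, y)) - y) has_field_derivative 1 * d - 1) (at 0)"
      by (rule DERIV_diff[OF DERIV_cmult[OF partials(4)] DERIV_ident])
    then have "deriv (\<lambda>y. 1 * snd (f (0, y)) - y) 0 = 1 * d - 1" by (rule DERIV_imp_deriv)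
    ultimately show ?thesis using h.cmod_multiplier_eq_1 \<open>a \<noteq> 0\<close> by simp
  qed
  have cd: "cnj d * d = 1" using \<open>cmod d = 1\<close> by (metis complex_norm_square mult.commute of_real_1 one_power2)
  obtain r K where "hypersurface_map P Q \<epsilon> \<delta> (\<lambda>x y. fst (f (x, y)) - x) (\<lambda>x y. cnj d * snd (f (x, y)) - y) r K"
    using germ_gives_hypersurface_map[OF U bih(2) hol f0 pres, of "cnj d"] \<open>cmod d = 1\<close> by auto
  then interpret h: hypersurface_map P Q \<epsilon> \<delta> "\<lambda>x y. fst (f (x, y)) - x" "\<lambda>x y. cnj d * snd (f (x, y)) - y" r K .
  have "((\<lambda>y. cnj d * snd (f (0, y)) - y) has_field_derivative cnj d * d - 1) (at 0)"
    by (rule DERIV_diff[OF DERIV_cmult[OF partials(4)] DERIV_ident])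
  then have "deriv (\<lambda>y. cnj d * snd (f (0, y)) - y) 0 = 0" using cd by (simp add: DERIV_imp_deriv)
  note van = h.displacement_vanishes[OF this]
  have "d = exp (\<i> * of_real (Arg d))"
  proof -
    have "d \<noteq> 0" using \<open>cmod d = 1\<close> by auto
    then show ?thesis using \<open>cmod d = 1\<close> cis_Arg[of d] by (simp add: cis_conv_exp sgn_eq)
  qed
  have "open (ball (0::complex) (r / 2) \<times> ball (0::complex) r)" by (intro open_Times) auto
  then have "\<forall>\<^sub>F v::complex \<times> complex in nhds 0. v \<in> ball 0 (r / 2) \<times> ball 0 r"
    using h.r_pos by (intro eventually_nhds_in_open) (auto simp: zero_prod_def)
  then have "\<forall>\<^sub>F v in nhds 0. f v = rotation (Arg d) v"
  proof eventually_elim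
    case (elim v)
    then have v: "fst (f v) = fst v" "cnj d * snd (f v) = snd v"
      using van[of "fst v" "snd v"] by auto
    have "snd (f v) = (cnj d * d) * snd (f v)" using cd by simp
    also have "\<dots> = snd v * d" using v(2) by (simp add: mult_ac)
    finally show ?case using v(1) \<open>d = exp (\<i> * of_real (Arg d))\<close> by (simp add: rotation_eq prod_eq_iff)
  qed
  then show ?thesis by blast
qed

end

theorem theoremB:
  fixes P :: "complex \<Rightarrow> real" and Q :: "complex \<times> real \<Rightarrow> real"
    and \<epsilon>\<^sub>0 \<delta>\<^sub>0 :: real and M :: "(complex \<times> complex) set"
  assumes "\<epsilon>\<^sub>0 > 0" and "\<delta>\<^sub>0 > 0"
    and "smooth_on {z. cmod z < \<epsilon>\<^sub>0} P"
    and "smooth_on ({z. cmod z < \<epsilon>\<^sub>0} \<times> {-\<delta>\<^sub>0<..<\<delta>\<^sub>0}) Q"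
    and "P 0 = 0" and "Q (0, 0) = 0"
    and "\<And>z. cmod z < \<epsilon>\<^sub>0 \<Longrightarrow> P z = P (of_real (cmod z))"
    and "\<And>z t. cmod z < \<epsilon>\<^sub>0 \<Longrightarrow> t \<in> {-\<delta>\<^sub>0<..<\<delta>\<^sub>0} \<Longrightarrow> Q (z, t) = Q (of_real (cmod z), t)"
    and "\<And>z. cmod z < \<epsilon>\<^sub>0 \<Longrightarrow> z \<noteq> 0 \<Longrightarrow> P z > 0"
    and "vanishes_to_infinite_order P 0"
    and "M = {(z1, z2). cmod z2 < \<epsilon>\<^sub>0 \<and> Im z1 \<in> {-\<delta>\<^sub>0<..<\<delta>\<^sub>0} \<and>
                Re z1 + P z2 + Im z1 * Q (z2, Im z1) = 0}"
  shows "stability_group M = {germ_at 0 (rotation t) | t :: real. True}"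
proof -
  interpret infinite_type_hypersurface P Q \<epsilon>\<^sub>0 \<delta>\<^sub>0
    by unfold_locales (use assms in blast)+
  have M: "M = infinite_type_hypersurface.M P Q \<epsilon>\<^sub>0 \<delta>\<^sub>0" unfolding assms(11) M_def ..
  show ?thesis
  proof (intro equalityI subsetI)
    fix G assume "G \<in> stability_group M"
    then obtain f U V where f: "G = germ_at 0 f" "0 \<in> U" "biholomorphic2 f U V" "f 0 = 0"
        "\<forall>\<^sub>F z in nhds 0. z \<in> M \<longrightarrow> f z \<in> M"
      unfolding stability_group_def by blast
    then obtain t where t: "\<forall>\<^sub>F v in nhds 0. f v = rotation t v"
      using germ_is_rotation[of f U V] M by auto
    have "germ_at 0 f = germ_at 0 (rotation t)"
      unfolding germ_at_def
      by (rule Collect_cong, rule eventually_subst, use t in eventually_elim) simp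
    then show "G \<in> {germ_at 0 (rotation t) | t. True}" using f(1) by blast
  next
    fix G assume "G \<in> {germ_at 0 (rotation t) | t. True}"
    then obtain t where G: "G = germ_at 0 (rotation t)" by blast
    have "rotation t v \<in> M" if "v \<in> M" for v
      using M_rotate[of "fst v" "snd v" "exp (\<i> * of_real t)"] that unfolding M
      by (simp add: rotation_eq mult.commute)
    moreover have "rotation t 0 = 0" by (simp add: rotation_eq zero_prod_def)
    ultimately show "G \<in> stability_group M"
      unfolding stability_group_def G using biholomorphic2_rotation[of t]
      by (intro CollectI exI[of _ "rotation t"]) (auto intro: always_eventually)
  qed
qed

end
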